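(* Let $n,N\in\mathbb{N}$, let $\Omega\subseteq\mathbb{R}^n$ be an open set and let $H:\Omega\times\mathbb{R}^{N\times n}\to[0,\infty)$ be a continuous function such that for every $x\in\Omega$ the function $P\mapsto H(x,P)$ is rank-one level-convex, i.e. the sublevel set $\{P\in\mathbb{R}^{N\times n}: H(x,P)\le t\}$ is a rank-one convex subset of $\mathbb{R}^{N\times n}$ for all $t\ge 0$ and all $x\in\Omega$. Let $u\in C^1(\Omega,\mathbb{R}^N)$ satisfy $$H\big(x,\mathrm{D}u(x)\big)=c\quad\text{for all }x\in\Omega,$$ for some constant $c\ge 0$. Then: (i) $u$ is a rank-one Absolute Minimiser of the functional $E_\infty(v,\Omega')=\operatorname{ess\,sup}_{x\in\Omega'}H(x,\mathrm{D}v(x))$, $\Omega'\Subset\Omega$, $v\in W^{1,\infty}_{\mathrm{loc}}(\Omega,\mathbb{R}^N)$; that is, for every open $\Omega'\Subset\Omega$, every $\phi\in W^{1,\infty}_0(\Omega')$ and every $\xi\in\mathbb{R}^N$, $$\operatorname*{ess\,sup}_{x\in\Omega'}H\big(x,\mathrm{D}u(x)\big)\le\operatorname*{ess\,sup}_{x\in\Omega'}H\big(x,\mathrm{D}u(x)+\xi\otimes\mathrm{D}\phi(x)\big).$$ (ii) In addition, for every open $\Omega'\Subset\Omega$, every $\phi\in W^{1,\infty}_0(\Omega')$ and every $\xi\in\mathbb{R}^N$, $$E_\infty(u,\Omega')\le\inf_{\mathbb{B}\in\mathcal{B}(\phi,\Omega')}E_\infty\big(u+\xi\phi,\mathbb{B}\big),$$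 where $\mathcal{B}(\phi,\Omega')$ is the set of all open balls $\mathbb{B}_\rho(x)\Subset\Omega'$ whose centre $x$ is a point of local extremum (local maximum or local minimum) of $\phi$ in $\Omega'$.
   Context: A set $\mathcal{C}\subseteq\mathbb{R}^{N\times n}$ is called rank-one convex if for all $A,B\in\mathcal{C}$ with $\mathrm{rk}(A-B)\le 1$ and all $\lambda\in[0,1]$ one has $\lambda A+(1-\lambda)B\in\mathcal{C}$. $U\Subset V$ means that $U$ is open and its closure is compact and contained in $V$. $\mathbb{B}_\rho(x)$ is the open ball in $\mathbb{R}^n$ of radius $\rho>0$ centred at $x$. For an open set $U$ and a map $v$ of class $W^{1,\infty}$ on $U$ with values in $\mathbb{R}^N$, $E_\infty(v,U):=\operatorname{ess\,sup}_{y\in U}H(y,\mathrm{D}v(y))$, where $\mathrm{D}v(y)\in\mathbb{R}^{N\times n}$ is the gradient matrix and the essential supremum is with respect to Lebesgue measure. $W^{1,\infty}_0(\Omega')$ denotes the scalar functions in $W^{1,\infty}(\Omega')$ vanishing on $\partial\Omega'$; such functions are identified with their continuous representatives, so local maxima and minima in $\Omega'$ are meant pointwise and are not required to be strict. For $\xi\in\mathbb{R}^N$ and $p\in\mathbb{R}^n$, $\xi\otimes p$ is the $N\times n$ matrix with entries $\xi_\alpha p_i$. *)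

theory Defs
  imports "HOL-Analysis.Analysis" "HOL-Probability.Essential_Supremum"
begin

text \<open>
  Matrices in \<open>\<real>\<^bsup>N\<times>n\<^esup>\<close> have type \<open>real^'n^'m\<close> with \<open>N = CARD('m)\<close> and \<open>n = CARD('n)\<close>;
  row \<open>\<alpha>\<close> of a gradient matrix is the gradient of the \<open>\<alpha>\<close>-th component.
\<close>

definition rank_one_convex :: "(real^'n^'m) set \<Rightarrow> bool" where
  "rank_one_convex C \<longleftrightarrow>
     (\<forall>A\<in>C. \<forall>B\<in>C. \<forall>l\<in>{0..1::real}. rank (A - B) \<le> 1 \<longrightarrow> l *\<^sub>R A + (1 - l) *\<^sub>R B \<in> C)"

definition rank_one_level_convex :: "'a set \<Rightarrow> ('a \<Rightarrow> real^'n^'m \<Rightarrow> real) \<Rightarrow> bool" where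
  "rank_one_level_convex \<Omega> H \<longleftrightarrow> (\<forall>x\<in>\<Omega>. \<forall>t\<ge>0. rank_one_convex {P. H x P \<le> t})"

definition tensor :: "real^'m \<Rightarrow> real^'n \<Rightarrow> real^'n^'m" where
  "tensor \<xi> p = (\<chi> \<alpha> i. \<xi> $ \<alpha> * p $ i)"

definition compactly_inside :: "'a::topological_space set \<Rightarrow> 'a set \<Rightarrow> bool" where
  "compactly_inside U V \<longleftrightarrow> open U \<and> compact (closure U) \<and> closure U \<subseteq> V"

definition C1_on :: "(real^'n) set \<Rightarrow> (real^'n \<Rightarrow> real^'m) \<Rightarrow> bool" where
  "C1_on \<Omega> u \<longleftrightarrow> (\<forall>x\<in>\<Omega>. u differentiable (at x)) \<and> continuous_on \<Omega> (\<lambda>x. jacobian u (at x))"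

subsection \<open>Weak derivatives\<close>

definition pderiv_at :: "'n \<Rightarrow> (real^'n \<Rightarrow> real) \<Rightarrow> real^'n \<Rightarrow> real" where
  "pderiv_at i f x = frechet_derivative f (at x) (axis i 1)"

primrec Ck :: "nat \<Rightarrow> (real^'n \<Rightarrow> real) \<Rightarrow> bool" where
  "Ck 0 f \<longleftrightarrow> continuous_on UNIV f"
| "Ck (Suc k) f \<longleftrightarrow> (\<forall>x. f differentiable (at x)) \<and> (\<forall>i. Ck k (pderiv_at i f))"

definition test_function :: "(real^'n) set \<Rightarrow> (real^'n \<Rightarrow> real) \<Rightarrow> bool" where
  "test_function U \<psi> \<longleftrightarrow>
     (\<forall>k. Ck k \<psi>) \<and> compact (closure {x. \<psi> x \<noteq> 0}) \<and> closure {x. \<psi> x \<noteq> 0} \<subseteq> U"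

definition locally_integrable :: "(real^'n) set \<Rightarrow> (real^'n \<Rightarrow> real) \<Rightarrow> bool" where
  "locally_integrable U f \<longleftrightarrow> (\<forall>K. compact K \<and> K \<subseteq> U \<longrightarrow> integrable (lebesgue_on K) f)"

definition has_weak_gradient ::
    "(real^'n) set \<Rightarrow> (real^'n \<Rightarrow> real) \<Rightarrow> (real^'n \<Rightarrow> real^'n) \<Rightarrow> bool" where
  "has_weak_gradient U f g \<longleftrightarrow>
     locally_integrable U f \<and>
     (\<forall>i. locally_integrable U (\<lambda>x. g x $ i) \<and>
       (\<forall>\<psi>. test_function U \<psi> \<longrightarrow>
          (LINT x|lebesgue_on U. f x * pderiv_at i \<psi> x)
            = - (LINT x|lebesgue_on U. g x $ i * \<psi> x)))"

text \<open>
  The weak gradient, when it exists, is determined only up to null sets. The operators below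
  choose one representative; they are used only under an essential supremum.
\<close>

definition weak_grad :: "(real^'n) set \<Rightarrow> (real^'n \<Rightarrow> real) \<Rightarrow> real^'n \<Rightarrow> real^'n" where
  "weak_grad U f = (SOME g. has_weak_gradient U f g)"

definition weak_jacobian ::
    "(real^'n) set \<Rightarrow> (real^'n \<Rightarrow> real^'m) \<Rightarrow> real^'n \<Rightarrow> real^'n^'m" where
  "weak_jacobian U v x = (\<chi> \<alpha>. weak_grad U (\<lambda>y. v y $ \<alpha>) x)"

subsection \<open>Sobolev spaces\<close>

definition L_inf :: "(real^'n) set \<Rightarrow> (real^'n \<Rightarrow> 'b::real_normed_vector) \<Rightarrow> bool" where
  "L_inf U f \<longleftrightarrow>
     f \<in> borel_measurable (lebesgue_on U) \<and> (\<exists>C. AE x in lebesgue_on U. norm (f x) \<le> C)"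

definition W1_inf :: "(real^'n) set \<Rightarrow> (real^'n \<Rightarrow> real) \<Rightarrow> bool" where
  "W1_inf U f \<longleftrightarrow> L_inf U f \<and> (\<exists>g. has_weak_gradient U f g \<and> L_inf U g)"

definition W1_inf_loc_vec :: "(real^'n) set \<Rightarrow> (real^'n \<Rightarrow> real^'m) \<Rightarrow> bool" where
  "W1_inf_loc_vec \<Omega> v \<longleftrightarrow> (\<forall>U. compactly_inside U \<Omega> \<longrightarrow> (\<forall>\<alpha>. W1_inf U (\<lambda>x. v x $ \<alpha>)))"

text \<open>The function itself is the continuous representative, up to the boundary.\<close>

definition W1_inf_0 :: "(real^'n) set \<Rightarrow> (real^'n \<Rightarrow> real) \<Rightarrow> bool" where
  "W1_inf_0 U \<phi> \<longleftrightarrow>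
     W1_inf U \<phi> \<and> continuous_on (closure U) \<phi> \<and> (\<forall>x\<in>frontier U. \<phi> x = 0)"

subsection \<open>The functional and its rank-one absolute minimisers\<close>

text \<open>
  The values are extended reals: an infimum over the empty family is \<open>\<infinity>\<close>, and the essential
  supremum over the empty set is \<open>-\<infinity>\<close>.
\<close>

definition E_inf ::
    "(real^'n \<Rightarrow> real^'n^'m \<Rightarrow> real) \<Rightarrow> (real^'n \<Rightarrow> real^'m) \<Rightarrow> (real^'n) set \<Rightarrow> ereal" where
  "E_inf H v U = esssup (lebesgue_on U) (\<lambda>x. ereal (H x (weak_jacobian U v x)))"

definition rank_one_absolute_minimiser ::
    "(real^'n \<Rightarrow> real^'n^'m \<Rightarrow> real) \<Rightarrow> (real^'n) set \<Rightarrow> (real^'n \<Rightarrow> real^'m) \<Rightarrow> bool" where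
  "rank_one_absolute_minimiser H \<Omega> u \<longleftrightarrow>
     W1_inf_loc_vec \<Omega> u \<and>
     (\<forall>\<Omega>' \<phi> \<xi>. compactly_inside \<Omega>' \<Omega> \<and> W1_inf_0 \<Omega>' \<phi> \<longrightarrow>
        E_inf H u \<Omega>' \<le>
          esssup (lebesgue_on \<Omega>')
            (\<lambda>x. ereal (H x (weak_jacobian \<Omega>' u x + tensor \<xi> (weak_grad \<Omega>' \<phi> x)))))"

definition local_extremum :: "(real^'n) set \<Rightarrow> (real^'n \<Rightarrow> real) \<Rightarrow> real^'n \<Rightarrow> bool" where
  "local_extremum U \<phi> x \<longleftrightarrow>
     x \<in> U \<and>
     ((\<forall>\<^sub>F y in at x within U. \<phi> y \<le> \<phi> x) \<or> (\<forall>\<^sub>F y in at x within U. \<phi> x \<le> \<phi> y))"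

definition extremal_balls :: "(real^'n \<Rightarrow> real) \<Rightarrow> (real^'n) set \<Rightarrow> (real^'n) set set" where
  "extremal_balls \<phi> U =
     {ball x \<rho> | x \<rho>. \<rho> > 0 \<and> compactly_inside (ball x \<rho>) U \<and> local_extremum U \<phi> x}"

end

theory Submission
  imports Defs "HOL-Real_Asymp.Real_Asymp"
begin

text \<open>
  Fix \<open>x\<^sub>0\<close> and a direction \<open>\<xi>\<close>. All matrices \<open>\<xi> \<otimes> p\<close> have rank at most one, so rank-one
  level-convexity makes \<open>{p. H x\<^sub>0 (Du(x\<^sub>0) + \<xi> \<otimes> p) \<le> t}\<close> an honestly convex closed subset of
  \<open>\<real>\<^sup>n\<close>. If the perturbed energy near \<open>x\<^sub>0\<close> were below \<open>t < c\<close>, this set would miss \<open>0\<close> and, by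
  continuity of \<open>H\<close>, contain \<open>D\<phi>(x)\<close> for almost every \<open>x\<close> near \<open>x\<^sub>0\<close> (after increasing \<open>t\<close>
  slightly). A hyperplane separating it from \<open>0\<close> gives \<open>a \<bullet> D\<phi> \<ge> b > 0\<close> almost everywhere, so
  \<open>\<phi>\<close> strictly increases along \<open>a\<close> and \<open>x\<^sub>0\<close> is not a local extremum. Part (ii) is this
  statement on a ball; for (i) note that \<open>\<phi>\<close>, vanishing on \<open>\<partial>\<Omega>'\<close>, has an extremum inside.
\<close>

section \<open>Smooth bump functions\<close>

text \<open>\<open>Ck (Suc k)\<close> speaks only of differentiability and of the partial
  derivatives, so the inclusion has to be pulled through the recursion; at the bottom,
  differentiability everywhere gives continuity.\<close>

lemma Ck_SucD: "Ck (Suc k) f \<Longrightarrow> Ck k f"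
proof (induction k arbitrary: f)
  case 0
  then show ?case
    by (auto intro!: differentiable_imp_continuous_on simp: differentiable_on_def differentiable_at_withinI)
next
  case (Suc k)
  then show ?case by auto
qed

lemma Ck_const: "Ck k (\<lambda>x::real^'n. c)"
proof (induction k arbitrary: c)
  case (Suc k)
  have "pderiv_at i (\<lambda>x. c) = (\<lambda>x. 0)" for i :: 'n and c :: real
    by (auto simp: pderiv_at_def)
  with Suc show ?case by simp
qed simp

lemma pderiv_at_eq: "(f has_derivative D) (at x) \<Longrightarrow> pderiv_at i f x = D (axis i 1)"
  by (simp add: pderiv_at_def frechet_derivative_at[symmetric])

lemma Ck_add: "Ck k f \<Longrightarrow> Ck k g \<Longrightarrow> Ck k (\<lambda>x. f x + g x)"
proof (induction k arbitrary: f g)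
  case (Suc k)
  have "pderiv_at i (\<lambda>x. f x + g x) = (\<lambda>x. pderiv_at i f x + pderiv_at i g x)" for i
  proof
    fix x
    have "f differentiable (at x)" "g differentiable (at x)" using Suc.prems by auto
    from has_derivative_add[OF this[unfolded frechet_derivative_works]]
    show "pderiv_at i (\<lambda>x. f x + g x) x = pderiv_at i f x + pderiv_at i g x"
      by (subst pderiv_at_eq) (auto simp: pderiv_at_def)
  qed
  with Suc show ?case by (auto intro!: differentiable_add)
qed (auto intro!: continuous_intros)

lemma pderiv_at_mult:
  assumes "f differentiable (at x)" "g differentiable (at x)"
  shows "pderiv_at i (\<lambda>x. f x * g x) x = f x * pderiv_at i g x + pderiv_at i f x * g x"
  using has_derivative_mult[OF assms[unfolded frechet_derivative_works]]
  by (subst pderiv_at_eq) (auto simp: pderiv_at_def)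

lemma Ck_mult: "Ck k f \<Longrightarrow> Ck k g \<Longrightarrow> Ck k (\<lambda>x. f x * g x)"
proof (induction k arbitrary: f g)
  case (Suc k)
  have "pderiv_at i (\<lambda>x. f x * g x) = (\<lambda>x. f x * pderiv_at i g x + pderiv_at i f x * g x)" for i
    using Suc.prems by (auto simp: pderiv_at_mult)
  moreover have "Ck k f" "Ck k g" using Suc.prems Ck_SucD by blast+
  ultimately show ?case using Suc by (auto intro!: Ck_add)
qed (auto intro!: continuous_intros)

lemma Ck_prod: "(\<And>i. i \<in> I \<Longrightarrow> Ck k (f i)) \<Longrightarrow> Ck k (\<lambda>x. \<Prod>i\<in>I. f i x)"
  by (induction I rule: infinite_finite_induct) (auto intro: Ck_const Ck_mult)

lemma pderiv_at_translate:
  assumes "\<And>x. f differentiable (at x)"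
  shows "pderiv_at i (\<lambda>x. f (x - v)) x = pderiv_at i f (x - v)"
proof -
  have "((\<lambda>x. f (x - v)) has_derivative frechet_derivative f (at (x - v))) (at x)"
    using assms[of "x-v", unfolded frechet_derivative_works]
    by (rule has_derivative_compose[of "\<lambda>x. x - v" "\<lambda>h. h", rotated])
       (auto intro!: derivative_eq_intros)
  then show ?thesis by (subst pderiv_at_eq) (auto simp: pderiv_at_def)
qed

lemma differentiable_translate:
  fixes f :: "'a::real_normed_vector \<Rightarrow> 'b::real_normed_vector"
  shows "f differentiable (at (x - v)) \<Longrightarrow> (\<lambda>x. f (x - v)) differentiable (at x)"
  by (rule differentiable_compose) auto

lemma Ck_translate: "Ck k f \<Longrightarrow> Ck k (\<lambda>x. f (x - v))"
proof (induction k arbitrary: f)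
  case 0
  then show ?case by (auto intro!: continuous_on_compose2[of UNIV f] continuous_intros)
next
  case (Suc k)
  have "pderiv_at i (\<lambda>x. f (x - v)) = (\<lambda>x. pderiv_at i f (x - v))" for i
    using Suc.prems by (auto simp: pderiv_at_translate)
  with Suc show ?case by (auto intro: differentiable_translate)
qed

section \<open>Flat functions and the bumps built from them\<close>

text \<open>The family is closed under differentiation (\<open>f\<^sub>n' = f\<^bsub>n+2\<^esub> - n f\<^bsub>n+1\<^esub>\<close>), which gives smoothness of \<open>exp (- 1 / t)\<close>.\<close>

definition flat :: "nat \<Rightarrow> real \<Rightarrow> real" where
  "flat n t = (if t > 0 then exp (- (1 / t)) / t ^ n else 0)"

text \<open>The left side is the difference quotient of \<open>flat n\<close> at 0, so the
  derivative at 0 becomes a limit of the next member of the family. At \<open>t = 0\<close> both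
  sides are 0, since \<open>0 / 0 = 0\<close>.\<close>

lemma flat_over: "(\<lambda>t. flat n t / t) = flat (Suc n)"
  by (auto simp: flat_def)

text \<open>From the right the exponential decay beats every power of \<open>1 / t\<close>; from the
  left the function is identically 0.\<close>

lemma flat_tendsto_0: "(flat n \<longlongrightarrow> 0) (at 0)"
proof -
  have "((\<lambda>t::real. exp (- (1 / t)) / t ^ n) \<longlongrightarrow> 0) (at_right 0)"
    by real_asymp
  then have "(flat n \<longlongrightarrow> 0) (at_right 0)"
    by (rule filterlim_mono_eventually[OF _ order_refl order_refl])
       (auto simp: eventually_at_right_field flat_def intro: exI[of _ 1])
  moreover have "(flat n \<longlongrightarrow> 0) (at_left 0)"
    by (rule tendsto_eventually) (auto simp: eventually_at_left_field flat_def intro!: exI[of _ "-1"])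
  ultimately show ?thesis by (simp add: filterlim_split_at)
qed

lemma flat_deriv: "(flat n has_real_derivative (flat (n + 2) t - n * flat (n + 1) t)) (at t)"
proof (cases t "0 :: real" rule: linorder_cases)
  case less
  have "((\<lambda>t. 0) has_real_derivative 0) (at t)" by simp
  then have "(flat n has_real_derivative 0) (at t)"
    by (rule has_field_derivative_transform_within_open[where S="{..<0}"]) (auto simp: flat_def less)
  then show ?thesis using less by (simp add: flat_def)
next
  case equal
  have "((\<lambda>h. flat (Suc n) h) \<longlongrightarrow> 0) (at 0)" by (rule flat_tendsto_0)
  then have "((\<lambda>h. (flat n (0 + h) - flat n 0) / h) \<longlongrightarrow> 0) (at 0)"
    by (simp add: flat_over flat_def[of _ 0])
  then have "(flat n has_real_derivative 0) (at 0)" by (simp add: DERIV_def)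
  then show ?thesis using equal by (simp add: flat_def)
next
  case greater
  have "((\<lambda>t. exp (- (1 / t)) / t ^ n) has_real_derivative
      exp (- (1 / t)) / t ^ (n+2) - n * (exp (- (1 / t)) / t ^ (n+1))) (at t)"
    using greater
    apply (auto intro!: derivative_eq_intros simp: field_simps power2_eq_square)
    apply (cases n; auto simp: field_simps)
    done
  then have "(flat n has_real_derivative exp (- (1 / t)) / t ^ (n+2) - n * (exp (- (1 / t)) / t ^ (n+1))) (at t)"
    by (rule has_field_derivative_transform_within_open[where S="{0<..}"]) (auto simp: flat_def greater)
  then show ?thesis using greater by (simp add: flat_def)
qed

text \<open>The index \<open>n\<close> stays arbitrary in the induction because differentiation
  raises it by one and by two. The affine argument serves both kinds of factors of
  \<open>bump\<close>.\<close>

lemma Ck_flat: "Ck k (\<lambda>x::real^'n. flat n (\<alpha> * x $ i + \<beta>))"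
proof (induction k arbitrary: n)
  case 0
  have "continuous_on UNIV (flat n)"
    using flat_deriv by (meson DERIV_isCont continuous_at_imp_continuous_on)
  then show ?case by (auto intro!: continuous_on_compose2[of UNIV "flat n"] continuous_intros)
next
  case (Suc k)
  let ?f = "\<lambda>n (x::real^'n). flat n (\<alpha> * x $ i + \<beta>)"
  have D: "(?f n has_derivative (\<lambda>h. (flat (n+2) (\<alpha> * x $ i + \<beta>) - n * flat (n + 1) (\<alpha> * x $ i + \<beta>)) * (\<alpha> * h $ i))) (at x)" for x
    by (rule has_derivative_compose[OF _ flat_deriv[unfolded has_field_derivative_def]])
       (auto intro!: derivative_eq_intros bounded_linear.has_derivative[OF bounded_linear_vec_nth])
  then have "\<forall>x. ?f n differentiable (at x)" by (auto simp: differentiable_def)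
  moreover have "Ck k (pderiv_at j (?f n))" for j
  proof -
    have "pderiv_at j (?f n) = (\<lambda>x. (\<alpha> * axis j 1 $ i) * ?f (n+2) x + (- n * \<alpha> * axis j 1 $ i) * ?f (n+1) x)"
      by (rule ext) (simp only: pderiv_at_eq[OF D], simp add: algebra_simps)
    moreover have "Ck k (\<lambda>x. (\<alpha> * axis j 1 $ i) * ?f (n+2) x + (- n * \<alpha> * axis j 1 $ i) * ?f (n+1) x)"
      by (rule Ck_add; rule Ck_mult; (rule Ck_const | rule Suc.IH))
    ultimately show ?thesis by metis
  qed
  ultimately show ?case by simp
qed

text \<open>There are two flat factors per coordinate, one for each of the two faces orthogonal to
  axis \<open>i\<close>. A positive \<open>m\<close> does not change the support but sharpens the
  bump: inside the box every factor tends to 1 as \<open>m\<close> grows. The arguments are spelled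
  as affine functions so that \<open>Ck_flat\<close> applies as it stands.\<close>

definition bump :: "real^'n \<Rightarrow> real^'n \<Rightarrow> real \<Rightarrow> real^'n \<Rightarrow> real" where
  "bump a b m x = (\<Prod>i\<in>UNIV. flat 0 (m * x $ i + (- m * a $ i)) * flat 0 ((- m) * x $ i + m * b $ i))"

lemma Ck_bump: "Ck k (bump a b m)"
  unfolding bump_def[abs_def] by (intro Ck_prod Ck_mult Ck_flat)

lemma flat0: "flat 0 t = (if t > 0 then exp (- (1 / t)) else 0)" by (simp add: flat_def)

lemma bump_nonneg: "0 \<le> bump a b m x"
  unfolding bump_def by (intro prod_nonneg) (auto simp: flat0)

lemma bump_le_1: "bump a b m x \<le> 1"
  unfolding bump_def by (intro prod_le_1) (auto simp: flat0 intro!: mult_le_one)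

lemma bump_pos_iff:
  assumes "m > 0" shows "bump a b m x > 0 \<longleftrightarrow> x \<in> box a b"
proof -
  have *: "0 < m * x $ i + - m * a $ i \<longleftrightarrow> a $ i < x $ i" "0 < - m * x $ i + m * b $ i \<longleftrightarrow> x $ i < b $ i" for i
    using mult_less_cancel_left_pos[OF assms, of "a $ i" "x $ i"] mult_less_cancel_left_pos[OF assms, of "x $ i" "b $ i"] by auto
  have "bump a b m x \<noteq> 0 \<longleftrightarrow> (\<forall>i. a $ i < x $ i \<and> x $ i < b $ i)"
    unfolding bump_def prod_zero_iff[OF finite] mult_eq_0_iff flat0 * by auto
  then show ?thesis using bump_nonneg[of a b m x] by (auto simp: mem_box_cart less_le)
qed

lemma bump_support: "m > 0 \<Longrightarrow> {x. bump a b m x \<noteq> 0} = box a b"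
  using bump_pos_iff[of m a b] bump_nonneg[of a b m] by (auto simp: less_le)

lemma test_function_bump:
  assumes "m > 0" "cbox a b \<subseteq> U"
  shows "test_function U (bump a b m)"
proof -
  have "closure (box a b) \<subseteq> cbox a b" by (simp add: box_subset_cbox closed_cbox closure_minimal)
  then show ?thesis
    unfolding test_function_def using assms
    by (auto simp: bump_support Ck_bump compact_closure bounded_box)
qed

text \<open>Inside the box every factor has the form \<open>exp (- 1 / (m * d))\<close> with
  \<open>d > 0\<close> the distance to a face, and tends to 1; outside, every bump vanishes.
  \<open>Suc m\<close> keeps the sharpness positive.\<close>

lemma bump_limit:
  fixes a b :: "real^'n"
  shows "(\<lambda>m. bump a b (real (Suc m)) x) \<longlonglongrightarrow> indicator (box a b) x"
proof (cases "x \<in> box a b")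
  case True
  have l: "(\<lambda>m. flat 0 (real (Suc m) * p + (- real (Suc m) * q))) \<longlonglongrightarrow> 1" if "q < p" for p q
  proof -
    have eq: "real (Suc m) * p + (- real (Suc m) * q) = real (Suc m) * (p - q)" for m by (simp add: algebra_simps)
    have "(\<lambda>m. exp (- (inverse (real (Suc m)) * (1 / (p - q))))) \<longlonglongrightarrow> exp (- (0 * (1 / (p - q))))"
      by (intro tendsto_intros LIMSEQ_inverse_real_of_nat)
    moreover have "flat 0 (real (Suc m) * p + (- real (Suc m) * q)) = exp (- (inverse (real (Suc m)) * (1 / (p - q))))" for m
      unfolding eq using that by (simp add: flat0 divide_simps zero_less_mult_iff del: of_nat_Suc)
    ultimately show ?thesis by simp
  qed
  have "(\<lambda>m. bump a b (real (Suc m)) x) \<longlonglongrightarrow> (\<Prod>i\<in>(UNIV::'n set). 1 * 1)"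
    unfolding bump_def
  proof (rule tendsto_prod, rule tendsto_mult)
    fix i :: 'n
    have *: "a $ i < x $ i" "x $ i < b $ i" using True by (auto simp: mem_box_cart)
    show "(\<lambda>m. flat 0 (real (Suc m) * x $ i + (- real (Suc m) * a $ i))) \<longlonglongrightarrow> 1" by (rule l[OF *(1)])
    show "(\<lambda>m. flat 0 (- real (Suc m) * x $ i + real (Suc m) * b $ i)) \<longlonglongrightarrow> 1" 
      by (subst add.commute) (rule l[OF *(2)])
  qed
  then show ?thesis using True by simp
next
  case False
  then have "bump a b (real (Suc m)) x = 0" for m
    using bump_support[of "real (Suc m)" a b] by auto
  then show ?thesis using False by simp
qed

section \<open>Integrals of compactly supported functions\<close>

lemma lebesgue_on_eq_of_support:
  fixes h :: "'a::euclidean_space \<Rightarrow> real"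
  assumes "A \<in> sets lebesgue" "\<And>x. x \<notin> A \<Longrightarrow> h x = 0"
  shows integral_lebesgue_on_support: "integral\<^sup>L (lebesgue_on A) h = integral\<^sup>L lebesgue h"
    and integrable_lebesgue_on_support: "integrable (lebesgue_on A) h \<longleftrightarrow> integrable lebesgue h"
proof -
  have "(\<lambda>x. indicator A x *\<^sub>R h x) = h" using assms(2) by (auto simp: fun_eq_iff indicator_def)
  with assms(1) show "integral\<^sup>L (lebesgue_on A) h = integral\<^sup>L lebesgue h"
    "integrable (lebesgue_on A) h \<longleftrightarrow> integrable lebesgue h"
    by (simp_all add: integral_restrict_space integrable_restrict_space)
qed

lemma continuous_on_compact_integrable:
  fixes h :: "'a::euclidean_space \<Rightarrow> real"
  assumes "compact K" "continuous_on K h"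
  shows "integrable (lebesgue_on K) h"
proof -
  have *: "integrable lborel (\<lambda>x. indicator K x *\<^sub>R h x)"
    using assms by (rule borel_integrable_compact)
  then have "integrable lebesgue (\<lambda>x. indicator K x *\<^sub>R h x)"
    by (simp add: integrable_completion borel_measurable_integrable)
  then show ?thesis
    using assms by (simp add: integrable_restrict_space lmeasurable_compact fmeasurableD)
qed

lemma integrable_continuous_support:
  fixes h :: "'a::euclidean_space \<Rightarrow> real"
  assumes "continuous_on K h" "compact K" "\<And>x. x \<notin> K \<Longrightarrow> h x = 0"
  shows "integrable lebesgue h" "integral\<^sup>L lebesgue h = integral K h"
proof -
  have K: "K \<in> sets lebesgue" using assms(2) by (simp add: lmeasurable_compact fmeasurableD)
  have i: "integrable (lebesgue_on K) h" by (rule continuous_on_compact_integrable) fact+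
  then show "integrable lebesgue h" using integrable_lebesgue_on_support[OF K, of h] assms(3) by auto
  show "integral\<^sup>L lebesgue h = integral K h"
    using has_integral_integral_lebesgue_on[OF i K] integral_lebesgue_on_support[OF K, of h] assms(3)
    by (simp add: integral_unique)
qed

lemma integral_lebesgue_translate:
  fixes h :: "'a::euclidean_space \<Rightarrow> real"
  assumes "h \<in> borel_measurable borel"
  shows "integral\<^sup>L lebesgue (\<lambda>x. h (x + v)) = integral\<^sup>L lebesgue h"
proof -
  have m: "h \<in> borel_measurable lborel" "(\<lambda>x. h (x + v)) \<in> borel_measurable lborel"
    using assms by measurable
  have "integral\<^sup>L lborel h = integral\<^sup>L (distr lborel borel ((+) v)) h"
    by (simp add: lborel_distr_plus)
  also have "\<dots> = integral\<^sup>L lborel (\<lambda>x. h (v + x))"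
    using assms by (intro integral_distr) auto
  finally show ?thesis using m by (simp add: integral_completion add.commute)
qed

lemma has_derivative_outside_support:
  fixes f :: "'a::real_normed_vector \<Rightarrow> real"
  assumes "x \<notin> closure {x. f x \<noteq> 0}"
  shows "(f has_derivative (\<lambda>_. 0)) (at x)"
proof -
  have "((\<lambda>_. 0::real) has_derivative (\<lambda>_. 0)) (at x)" by simp
  then show ?thesis
    by (rule has_derivative_transform_within_open[where s = "- closure {x. f x \<noteq> 0}"])
       (use assms closure_subset[of "{x. f x \<noteq> 0}"] in \<open>auto simp: open_Compl\<close>)
qed

text \<open>The whole space is covered by two open sets: \<open>V\<close>, where both factors are
  continuous, and the complement of \<open>closure S\<close>, where the product is 0. So
  \<open>f\<close> may behave arbitrarily outside \<open>V\<close>.\<close>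

lemma continuous_on_mult_support:
  fixes f \<psi> :: "'a::real_normed_vector \<Rightarrow> real"
  assumes "open V" "continuous_on V f" "continuous_on V \<psi>" "closure S \<subseteq> V" "\<And>x. x \<notin> S \<Longrightarrow> \<psi> x = 0"
  shows "continuous_on UNIV (\<lambda>x. f x * \<psi> x)"
proof -
  have "continuous_on V (\<lambda>x. f x * \<psi> x)" using assms by (intro continuous_intros)
  moreover have "continuous_on (- closure S) (\<lambda>x. f x * \<psi> x)"
    by (rule continuous_on_cong[THEN iffD2, OF refl, of _ _ "\<lambda>_. 0"])
       (use assms(5) closure_subset[of S] in auto)
  ultimately have "continuous_on (V \<union> - closure S) (\<lambda>x. f x * \<psi> x)"
    by (intro continuous_on_open_Un) (use assms(1) in auto)
  moreover have "V \<union> - closure S = UNIV" using assms(4) by auto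
  ultimately show ?thesis by simp
qed

text \<open>Applied to the product of a function and a test function, this is integration by parts
  in direction \<open>e\<close>.\<close>

lemma integral_directional_derivative_eq_0:
  fixes f :: "'a::euclidean_space \<Rightarrow> real"
  assumes D: "\<And>x. (f has_derivative f' x) (at x)"
    and cont: "continuous_on UNIV (\<lambda>x. f' x e)"
    and K: "bounded K" "\<And>x. x \<notin> K \<Longrightarrow> f x = 0"
  shows "integral\<^sup>L lebesgue (\<lambda>x. f' x e) = 0"
proof -
  obtain R where R: "\<And>x. x \<in> K \<Longrightarrow> norm x \<le> R" using K(1) by (auto simp: bounded_iff)
  \<comment> \<open>The margin \<open>norm e\<close> around the support leaves room for every
    translate by \<open>s *\<^sub>R e\<close> with \<open>s\<close> in \<open>{-1..1}\<close>, so
    one fixed box serves for all of them.\<close>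
  obtain p q where pq: "cball 0 (R + norm e) \<subseteq> cbox p (q::'a)"
    using bounded_subset_cbox_symmetric[OF bounded_cball] by metis
  have fz: "f x = 0" if "R < norm x" for x using that K(2) R by force
  have f'z: "f' x e = 0" if "R < norm x" for x
  proof -
    have "((\<lambda>_. 0::real) has_derivative (\<lambda>_. 0)) (at x)" by simp
    then have "(f has_derivative (\<lambda>_. 0)) (at x)"
      by (rule has_derivative_transform_within_open[where s = "{y. R < norm y}"])
         (use that fz in \<open>auto intro!: open_Collect_less continuous_intros\<close>)
    from has_derivative_unique[OF this D] show ?thesis by metis
  qed
  have cf: "continuous_on UNIV f"
    using D by (meson continuous_at_imp_continuous_on has_derivative_continuous)
  define F where "F s = integral (cbox p q) (\<lambda>x. f (x + s *\<^sub>R e))" for s :: real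
  have F: "F s = integral\<^sup>L lebesgue f" if "s \<in> {-1..1}" for s
  proof -
    have "f (x + s *\<^sub>R e) = 0" if "x \<notin> cbox p q" for x
    proof (rule fz)
      have "R + norm e < norm x" using that pq by (force simp: not_le[symmetric])
      moreover have "norm x \<le> norm (x + s *\<^sub>R e) + norm (s *\<^sub>R e)"
        using norm_triangle_ineq4[of "x + s *\<^sub>R e" "s *\<^sub>R e"] by simp
      moreover have "norm (s *\<^sub>R e) \<le> norm e"
        using \<open>s \<in> {-1..1}\<close> by (auto intro!: mult_left_le_one_le)
      ultimately show "R < norm (x + s *\<^sub>R e)" by linarith
    qed
    then have "F s = integral\<^sup>L lebesgue (\<lambda>x. f (x + s *\<^sub>R e))"
      unfolding F_def by (intro integrable_continuous_support(2)[symmetric])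
        (auto intro!: continuous_on_compose2[OF cf] continuous_intros)
    also have "\<dots> = integral\<^sup>L lebesgue f"
      by (rule integral_lebesgue_translate) (use cf borel_measurable_continuous_onI in blast)
    finally show ?thesis .
  qed
  \<comment> \<open>By translation invariance \<open>F\<close> is constant near \<open>0\<close>; its derivative there is the integral in question.\<close>
  have "(F has_vector_derivative integral (cbox p q) (\<lambda>x. f' (x + 0 *\<^sub>R e) e)) (at 0 within {-1..1})"
    unfolding F_def
  proof (rule leibniz_rule_vector_derivative[where fx = "\<lambda>s x. f' (x + s *\<^sub>R e) e"])
    fix s x
    have "((\<lambda>s. f (x + s *\<^sub>R e)) has_derivative (\<lambda>h. f' (x + s *\<^sub>R e) (h *\<^sub>R e))) (at s within {-1..1})"
      by (rule has_derivative_compose[OF _ D]) (auto intro!: derivative_eq_intros)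
    then show "((\<lambda>s. f (x + s *\<^sub>R e)) has_vector_derivative f' (x + s *\<^sub>R e) e) (at s within {-1..1})"
      unfolding has_vector_derivative_def
      using linear_cmul[OF has_derivative_linear[OF D]] by simp
  next
    fix s show "(\<lambda>x. f (x + s *\<^sub>R e)) integrable_on cbox p q"
      by (intro integrable_continuous) (auto intro!: continuous_on_compose2[OF cf] continuous_intros)
  next
    show "continuous_on ({-1..1} \<times> cbox p q) (\<lambda>(s, x). f' (x + s *\<^sub>R e) e)"
      unfolding split_beta by (auto intro!: continuous_on_compose2[OF cont] continuous_intros)
  qed auto
  moreover have "(F has_vector_derivative 0) (at 0 within {-1..1})"
    by (rule has_vector_derivative_transform[of _ _ _ "\<lambda>_. integral\<^sup>L lebesgue f"]) (auto simp: F)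
  ultimately have "integral (cbox p q) (\<lambda>x. f' x e) = 0"
    using vector_derivative_unique_within_closed_interval[of "-1" 1 0 F] by auto
  moreover have "f' x e = 0" if "x \<notin> cbox p q" for x
  proof (rule f'z)
    have "R + norm e < norm x" using that pq by (force simp: not_le[symmetric])
    then show "R < norm x" by (smt (verit) norm_ge_zero)
  qed
  ultimately show ?thesis
    by (subst integrable_continuous_support(2)[of "cbox p q"]) (auto intro: continuous_on_subset[OF cont])
qed

section \<open>Calculus of weak gradients\<close>

lemma frechet_derivative_eq_sum_pderiv:
  assumes "f differentiable (at x)"
  shows "frechet_derivative f (at x) e = (\<Sum>i\<in>UNIV. e $ i * pderiv_at i f x)"
proof -
  have lin: "linear (frechet_derivative f (at x))" using assms by (rule linear_frechet_derivative)
  have "frechet_derivative f (at x) (\<Sum>i\<in>UNIV. e $ i *s axis i 1) = (\<Sum>i\<in>UNIV. e $ i * pderiv_at i f x)"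
    by (simp add: linear_sum[OF lin] linear_cmul[OF lin] pderiv_at_def scalar_mult_eq_scaleR)
  then show ?thesis by (simp add: basis_expansion)
qed

lemma test_functionD:
  assumes "test_function U \<psi>"
  shows "\<psi> differentiable (at x)" "continuous_on S \<psi>" "continuous_on S (pderiv_at i \<psi>)"
    "compact (closure {x. \<psi> x \<noteq> 0})" "closure {x. \<psi> x \<noteq> 0} \<subseteq> U"
proof -
  have "Ck 0 \<psi>" "Ck (Suc 0) \<psi>" using assms by (auto simp: test_function_def simp del: Ck.simps)
  then show "\<psi> differentiable (at x)" "continuous_on S \<psi>" "continuous_on S (pderiv_at i \<psi>)"
    by (auto intro: continuous_on_subset)
qed (use assms in \<open>auto simp: test_function_def\<close>)

lemma zero_outside_support:
  fixes f :: "real^'n \<Rightarrow> real"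
  assumes "x \<notin> closure {x. f x \<noteq> 0}"
  shows "f x = 0" "pderiv_at i f x = 0"
  using assms closure_subset[of "{x. f x \<noteq> 0}"] pderiv_at_eq[OF has_derivative_outside_support[OF assms]] by auto

lemma locally_integrable_mult_integrable:
  assumes f: "locally_integrable U f" and K: "compact K" "K \<subseteq> U"
    and \<psi>: "continuous_on K \<psi>" "\<And>x. x \<notin> K \<Longrightarrow> \<psi> x = 0"
  shows "integrable lebesgue (\<lambda>x. f x * \<psi> x)"
proof -
  have Km: "K \<in> sets lebesgue" using K by (simp add: lmeasurable_compact fmeasurableD)
  have i: "integrable (lebesgue_on K) f" using f K by (auto simp: locally_integrable_def)
  obtain B where B: "\<And>x. x \<in> K \<Longrightarrow> \<bar>\<psi> x\<bar> \<le> B"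
    using compact_imp_bounded[OF compact_continuous_image[OF \<psi>(1) K(1)]] by (auto simp: bounded_iff)
  have "integrable (lebesgue_on K) (\<lambda>x. f x * \<psi> x)"
  proof (rule Bochner_Integration.integrable_bound)
    show "integrable (lebesgue_on K) (\<lambda>x. B * f x)" using i by simp
    show "(\<lambda>x. f x * \<psi> x) \<in> borel_measurable (lebesgue_on K)"
      using \<psi>(1) Km by (intro borel_measurable_times[OF borel_measurable_integrable[OF i]]
        continuous_imp_measurable_on_sets_lebesgue)
    show "AE x in lebesgue_on K. norm (f x * \<psi> x) \<le> norm (B * f x)"
    proof (rule AE_I2)
      fix x assume "x \<in> space (lebesgue_on K)"
      then have "\<bar>\<psi> x\<bar> \<le> \<bar>B\<bar>" using B[of x] by auto
      then show "norm (f x * \<psi> x) \<le> norm (B * f x)"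
        by (simp add: abs_mult mult.commute mult_right_mono)
    qed
  qed
  then show ?thesis using integrable_lebesgue_on_support[OF Km, of "\<lambda>x. f x * \<psi> x"] \<psi>(2) by simp
qed

lemma test_function_integrable:
  assumes f: "locally_integrable U f" and \<psi>: "test_function U \<psi>"
  shows "integrable lebesgue (\<lambda>x. f x * \<psi> x)" "integrable lebesgue (\<lambda>x. f x * pderiv_at i \<psi> x)"
proof -
  note int = locally_integrable_mult_integrable[OF f test_functionD(4,5)[OF \<psi>]]
  show "integrable lebesgue (\<lambda>x. f x * \<psi> x)"
    by (rule int[OF test_functionD(2)[OF \<psi>]]) (rule zero_outside_support(1))
  show "integrable lebesgue (\<lambda>x. f x * pderiv_at i \<psi> x)"
    by (rule int[OF test_functionD(3)[OF \<psi>]]) (rule zero_outside_support(2))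
qed

lemma test_function_integral_on:
  assumes "open U" "test_function U \<psi>"
  shows "integral\<^sup>L (lebesgue_on U) (\<lambda>x. f x * \<psi> x) = integral\<^sup>L lebesgue (\<lambda>x. f x * \<psi> x)"
    "integral\<^sup>L (lebesgue_on U) (\<lambda>x. f x * pderiv_at i \<psi> x) = integral\<^sup>L lebesgue (\<lambda>x. f x * pderiv_at i \<psi> x)"
proof -
  have "\<psi> x = 0" "pderiv_at i \<psi> x = 0" if "x \<notin> U" for x
    using that zero_outside_support[of x \<psi>] test_functionD(5)[OF assms(2)] by blast+
  then show "integral\<^sup>L (lebesgue_on U) (\<lambda>x. f x * \<psi> x) = integral\<^sup>L lebesgue (\<lambda>x. f x * \<psi> x)"
    "integral\<^sup>L (lebesgue_on U) (\<lambda>x. f x * pderiv_at i \<psi> x) = integral\<^sup>L lebesgue (\<lambda>x. f x * pderiv_at i \<psi> x)"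
    using assms(1) by (auto intro!: integral_lebesgue_on_support)
qed

text \<open>Test functions vanish outside \<open>U\<close>, so both integrals may be taken over the
  whole space, where translation invariance and integration by parts are available.\<close>

lemma has_weak_gradient_iff:
  assumes "open U"
  shows "has_weak_gradient U f g \<longleftrightarrow> locally_integrable U f \<and>
     (\<forall>i. locally_integrable U (\<lambda>x. g x $ i) \<and>
       (\<forall>\<psi>. test_function U \<psi> \<longrightarrow>
          (LINT x|lebesgue. f x * pderiv_at i \<psi> x) = - (LINT x|lebesgue. g x $ i * \<psi> x)))"
  unfolding has_weak_gradient_def by (auto simp: test_function_integral_on[OF assms])

lemma locally_integrable_continuous: "continuous_on U f \<Longrightarrow> locally_integrable U f"
  by (auto simp: locally_integrable_def intro: continuous_on_compact_integrable continuous_on_subset)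

text \<open>The product of \<open>f\<close> with a test function is differentiable on the whole
  space with continuous partial derivatives, although \<open>f\<close> is controlled only on
  \<open>U\<close>. Its partial derivatives integrate to 0, and the product rule splits this into
  the defining identity.\<close>

lemma has_weak_gradient_classical:
  fixes f :: "real^'n \<Rightarrow> real"
  assumes U: "open U" and f: "\<And>x. x \<in> U \<Longrightarrow> f differentiable (at x)"
    and f': "\<And>i. continuous_on U (pderiv_at i f)"
  shows "has_weak_gradient U f (\<lambda>x. \<chi> i. pderiv_at i f x)"
proof -
  have cf: "continuous_on U f"
    using f by (meson continuous_at_imp_continuous_on differentiable_imp_continuous_within)
  have "(LINT x|lebesgue. f x * pderiv_at i \<psi> x) = - (LINT x|lebesgue. pderiv_at i f x * \<psi> x)"
    if \<psi>: "test_function U \<psi>" for i \<psi>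
  proof -
    note \<psi>D = test_functionD[OF \<psi>]
    \<comment> \<open>Outside \<open>U\<close> nothing is known about the derivative of
      \<open>f\<close>; the value 0 is the true derivative of the product there, since
      \<open>\<psi>\<close> vanishes near every point outside \<open>U\<close>.\<close>
    define D where "D x h = (if x \<in> U then f x * frechet_derivative \<psi> (at x) h + frechet_derivative f (at x) h * \<psi> x else 0)" for x h
    have D: "((\<lambda>x. f x * \<psi> x) has_derivative D x) (at x)" for x
    proof (cases "x \<in> U")
      case True
      have "((\<lambda>x. f x * \<psi> x) has_derivative (\<lambda>h. f x * frechet_derivative \<psi> (at x) h + frechet_derivative f (at x) h * \<psi> x)) (at x)"
        using f[OF True] \<psi>D(1)[of x] unfolding frechet_derivative_works by (rule has_derivative_mult)
      then show ?thesis using True by (simp add: D_def[abs_def])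
    next
      case False
      then have "x \<notin> closure {x. \<psi> x \<noteq> 0}" using \<psi>D(5) by blast
      moreover have "closure {x. f x * \<psi> x \<noteq> 0} \<subseteq> closure {x. \<psi> x \<noteq> 0}" by (rule closure_mono) auto
      ultimately show ?thesis using False
        by (simp add: D_def[abs_def]) (rule has_derivative_outside_support, auto)
    qed
    have Deq: "D x (axis i 1) = f x * pderiv_at i \<psi> x + pderiv_at i f x * \<psi> x" for x
    proof (cases "x \<in> U")
      case True
      then show ?thesis by (simp add: D_def pderiv_at_def)
    next
      case False
      then have "x \<notin> closure {x. \<psi> x \<noteq> 0}" using \<psi>D(5) by blast
      from zero_outside_support[OF this] False show ?thesis by (simp add: D_def)
    qed
    have "integral\<^sup>L lebesgue (\<lambda>x. D x (axis i 1)) = 0"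
    proof (rule integral_directional_derivative_eq_0[OF D])
      show "continuous_on UNIV (\<lambda>x. D x (axis i 1))"
        unfolding Deq
      proof (rule continuous_on_add)
        have S: "closure (closure {x. \<psi> x \<noteq> 0}) \<subseteq> U" using \<psi>D(5) by simp
        show "continuous_on UNIV (\<lambda>x. f x * pderiv_at i \<psi> x)"
          by (rule continuous_on_mult_support[OF U cf \<psi>D(3) S]) (rule zero_outside_support(2))
        show "continuous_on UNIV (\<lambda>x. pderiv_at i f x * \<psi> x)"
          by (rule continuous_on_mult_support[OF U f' \<psi>D(2) S]) (rule zero_outside_support(1))
      qed
      show "bounded (closure {x. \<psi> x \<noteq> 0})" using \<psi>D(4) by (rule compact_imp_bounded)
      show "f x * \<psi> x = 0" if "x \<notin> closure {x. \<psi> x \<noteq> 0}" for x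
        using zero_outside_support(1)[OF that] by simp
    qed
    then have "integral\<^sup>L lebesgue (\<lambda>x. f x * pderiv_at i \<psi> x) + integral\<^sup>L lebesgue (\<lambda>x. pderiv_at i f x * \<psi> x) = 0"
      unfolding Deq
      by (subst (asm) Bochner_Integration.integral_add)
         (auto intro!: test_function_integrable[OF _ \<psi>] locally_integrable_continuous cf f')
    then show ?thesis by linarith
  qed
  then show ?thesis
    by (simp add: has_weak_gradient_iff[OF U] locally_integrable_continuous cf f')
qed

lemma has_weak_gradient_subset:
  assumes "has_weak_gradient U f g" "open U" "open V" "V \<subseteq> U"
  shows "has_weak_gradient V f g"
proof -
  have "test_function V \<psi> \<Longrightarrow> test_function U \<psi>" for \<psi> using assms(4) by (auto simp: test_function_def)
  moreover have "locally_integrable U h \<Longrightarrow> locally_integrable V h" for h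
    using assms(4) by (auto simp: locally_integrable_def)
  ultimately show ?thesis using assms(1) by (auto simp: has_weak_gradient_iff assms(2,3))
qed

lemma locally_integrable_add_scaled:
  "locally_integrable U f \<Longrightarrow> locally_integrable U h \<Longrightarrow> locally_integrable U (\<lambda>x. f x + a * h x)"
  by (auto simp: locally_integrable_def)

lemma has_weak_gradient_add_scaled:
  assumes "has_weak_gradient U f g" "has_weak_gradient U h k" "open U"
  shows "has_weak_gradient U (\<lambda>x. f x + a * h x) (\<lambda>x. g x + a *\<^sub>R k x)"
proof -
  note * = assms(1,2)[unfolded has_weak_gradient_iff[OF assms(3)]]
  show ?thesis
    unfolding has_weak_gradient_iff[OF assms(3)]
  proof (intro conjI allI impI)
    show "locally_integrable U (\<lambda>x. f x + a * h x)" using * by (blast intro: locally_integrable_add_scaled)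
    fix i
    show "locally_integrable U (\<lambda>x. (g x + a *\<^sub>R k x) $ i)"
      using * by (simp add: locally_integrable_add_scaled)
    fix \<psi> assume \<psi>: "test_function U \<psi>"
    note int = test_function_integrable[OF _ \<psi>]
    have "(LINT x|lebesgue. (f x + a * h x) * pderiv_at i \<psi> x) =
       (LINT x|lebesgue. f x * pderiv_at i \<psi> x) + a * (LINT x|lebesgue. h x * pderiv_at i \<psi> x)"
      using * by (simp add: distrib_right mult.assoc Bochner_Integration.integral_add int)
    also have "\<dots> = - ((LINT x|lebesgue. g x $ i * \<psi> x) + a * (LINT x|lebesgue. k x $ i * \<psi> x))"
      using * \<psi> by simp
    also have "\<dots> = - (LINT x|lebesgue. (g x + a *\<^sub>R k x) $ i * \<psi> x)"
      using * by (simp add: distrib_right mult.assoc Bochner_Integration.integral_add int)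
    finally show "(LINT x|lebesgue. (f x + a * h x) * pderiv_at i \<psi> x) = - (LINT x|lebesgue. (g x + a *\<^sub>R k x) $ i * \<psi> x)" .
  qed
qed

text \<open>The definition tests coordinate directions only; the identities for
  \<open>axis i 1\<close> combine linearly with the coefficients \<open>e $ i\<close>.\<close>

lemma has_weak_gradient_directional:
  assumes "has_weak_gradient U f g" "open U" "test_function U \<psi>"
  shows "integrable lebesgue (\<lambda>x. f x * frechet_derivative \<psi> (at x) e)"
    "integrable lebesgue (\<lambda>x. (g x \<bullet> e) * \<psi> x)"
    "(LINT x|lebesgue. f x * frechet_derivative \<psi> (at x) e) = - (LINT x|lebesgue. (g x \<bullet> e) * \<psi> x)"
proof -
  note * = assms(1)[unfolded has_weak_gradient_iff[OF assms(2)]]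
  note int = test_function_integrable[OF _ assms(3)]
  have eq: "f x * frechet_derivative \<psi> (at x) e = (\<Sum>i\<in>UNIV. e $ i * (f x * pderiv_at i \<psi> x))"
    "(g x \<bullet> e) * \<psi> x = (\<Sum>i\<in>UNIV. e $ i * (g x $ i * \<psi> x))" for x
    by (simp_all add: frechet_derivative_eq_sum_pderiv test_functionD[OF assms(3)] sum_distrib_left
        sum_distrib_right inner_vec_def mult_ac)
  show "integrable lebesgue (\<lambda>x. f x * frechet_derivative \<psi> (at x) e)"
    "integrable lebesgue (\<lambda>x. (g x \<bullet> e) * \<psi> x)"
    unfolding eq using * by (auto intro!: Bochner_Integration.integrable_sum int)
  show "(LINT x|lebesgue. f x * frechet_derivative \<psi> (at x) e) = - (LINT x|lebesgue. (g x \<bullet> e) * \<psi> x)"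
    unfolding eq using * assms(3)
    by (simp add: Bochner_Integration.integral_sum int sum_negf)
qed

section \<open>The fundamental lemma of the calculus of variations and uniqueness of weak
  gradients\<close>

text \<open>The bumps over \<open>cbox c d\<close> tend to its indicator function as they become sharper.\<close>
lemma integral_cbox_eq_0_of_test_functions:
  assumes h: "locally_integrable U h" and U: "open U" and cd: "cbox c d \<subseteq> U"
    and 0: "\<And>\<psi>. test_function U \<psi> \<Longrightarrow> (LINT x|lebesgue. h x * \<psi> x) = 0"
  shows "integral (cbox c d) h = 0"
proof -
  let ?M = "lebesgue_on (cbox c d)"
  have i: "integrable ?M h" using h cd by (auto simp: locally_integrable_def)
  have b: "bump c d (real (Suc m)) x = 0" if "x \<notin> cbox c d" for x m
    using bump_support[of "real (Suc m)" c d] that box_subset_cbox[of c d] by auto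
  have "(\<lambda>m. LINT x|?M. h x * bump c d (real (Suc m)) x) \<longlonglongrightarrow> (LINT x|?M. h x * indicator (box c d) x)"
  proof (rule integral_dominated_convergence[where w = "\<lambda>x. norm (h x)"])
    show "integrable ?M (\<lambda>x. norm (h x))" using i by simp
    show "(\<lambda>x. h x * indicator (box c d) x) \<in> borel_measurable ?M"
    proof (rule borel_measurable_times[OF borel_measurable_integrable[OF i]], rule borel_measurable_indicator)
      show "box c d \<in> sets ?M" using box_subset_cbox[of c d] by (simp add: sets_restrict_space_iff)
    qed
    fix m
    have "continuous_on (cbox c d) (bump c d (real (Suc m)))"
      using Ck_bump[of 0 c d "real (Suc m)"] continuous_on_subset by auto
    then show "(\<lambda>x. h x * bump c d (real (Suc m)) x) \<in> borel_measurable ?M"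
      by (rule borel_measurable_times[OF borel_measurable_integrable[OF i]
        continuous_imp_measurable_on_sets_lebesgue]) simp
    have "norm (h x * bump c d (real (Suc m)) x) \<le> norm (h x)" for x
      using mult_left_le[OF bump_le_1[of c d "real (Suc m)" x], of "\<bar>h x\<bar>"]
      by (simp add: abs_mult bump_nonneg del: of_nat_Suc)
    then show "AE x in ?M. norm (h x * bump c d (real (Suc m)) x) \<le> norm (h x)" by blast
  next
    show "AE x in ?M. (\<lambda>m. h x * bump c d (real (Suc m)) x) \<longlonglongrightarrow> h x * indicator (box c d) x"
      by (rule AE_I2) (rule tendsto_mult_left[OF bump_limit])
  qed
  moreover have "(LINT x|?M. h x * bump c d (real (Suc m)) x) = 0" for m
  proof -
    have "(LINT x|?M. h x * bump c d (real (Suc m)) x) = (LINT x|lebesgue. h x * bump c d (real (Suc m)) x)"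
      by (rule integral_lebesgue_on_support) (simp_all add: b del: of_nat_Suc)
    also have "\<dots> = 0" by (rule 0[OF test_function_bump]) (use cd in auto)
    finally show ?thesis .
  qed
  ultimately have "(\<lambda>m::nat. 0) \<longlonglongrightarrow> (LINT x|?M. h x * indicator (box c d) x)" by simp
  then have "0 = (LINT x|?M. h x * indicator (box c d) x)" by (rule LIMSEQ_unique[OF tendsto_const])
  also have "\<dots> = integral (cbox c d) (\<lambda>x. h x * indicator (box c d) x)"
    using box_subset_cbox[of c d]
    by (intro lebesgue_integral_eq_integral integrable_real_mult_indicator[OF _ i])
       (simp_all add: sets_restrict_space_iff)
  also have "\<dots> = integral (cbox c d) h"
    by (rule integral_spike[OF negligible_frontier_interval[of c d]]) auto
  finally show ?thesis by simp
qed

text \<open>On a closed box in \<open>U\<close>, the function extended by 0 has zero integral over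
  every box, so Lebesgue differentiation forces it to vanish almost everywhere. Countably many such
  boxes exhaust \<open>U\<close>.\<close>

lemma locally_integrable_AE_0:
  fixes h :: "real^'n \<Rightarrow> real"
  assumes h: "locally_integrable U h" and U: "open U"
    and 0: "\<And>\<psi>. test_function U \<psi> \<Longrightarrow> (LINT x|lebesgue. h x * \<psi> x) = 0"
  shows "AE x in lebesgue_on U. h x = 0"
proof -
  have K: "negligible {x \<in> cbox c d. h x \<noteq> 0}" if cd: "cbox c d \<subseteq> U" for c d
  proof -
    let ?h = "\<lambda>x. if x \<in> cbox c d then h x else 0"
    have i: "h integrable_on cbox c d"
      using h cd by (auto simp: locally_integrable_def intro: integrable_on_lebesgue_on)
    have I: "?h integrable_on cbox a b" "integral (cbox a b) ?h = 0" for a b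
    proof -
      \<comment> \<open>Two boxes intersect in a box, possibly empty, so every box integral of
        \<open>?h\<close> is an integral of \<open>h\<close> over a box inside
        \<open>U\<close>.\<close>
      obtain p q where pq: "cbox c d \<inter> cbox a b = cbox p q" by (meson Int_interval)
      have "cbox p q \<subseteq> cbox c d" using pq by blast
      with i have "h integrable_on cbox p q" by (rule integrable_on_subcbox)
      then show "?h integrable_on cbox a b" using pq by (simp add: integrable_restrict_Int)
      show "integral (cbox a b) ?h = 0"
        using integral_cbox_eq_0_of_test_functions[OF h U _ 0, of p q] \<open>cbox p q \<subseteq> cbox c d\<close> pq cd
        by (simp add: integral_restrict_Int)
    qed
    \<comment> \<open>Lebesgue differentiation: off a null set, the averages over small cubes with
      corner \<open>x\<close> converge to \<open>?h x\<close>. All these averages are 0.\<close>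
    obtain N where N: "negligible N" and lim: "\<And>x e. \<lbrakk>x \<notin> N; 0 < e\<rbrakk> \<Longrightarrow> \<exists>\<delta>>0. \<forall>t. 0 < t \<and> t < \<delta> \<longrightarrow>
        norm (integral (cbox x (x + t *\<^sub>R One)) ?h /\<^sub>R t ^ DIM(real^'n) - ?h x) < e"
    proof (rule integrable_ccontinuous_explicit[OF I(1)], goal_cases)
      case (1 N)
      show thesis by (rule 1(1)[OF 1(2) 1(3)])
    qed
    have "?h x = 0" if x: "x \<notin> N" for x
    proof (rule ccontr)
      assume "?h x \<noteq> 0"
      then have "0 < norm (?h x)" unfolding zero_less_norm_iff .
      from lim[OF x this, unfolded I(2)]
      obtain \<delta> where "0 < \<delta> \<and> (\<forall>t. 0 < t \<and> t < \<delta> \<longrightarrow> norm (0 /\<^sub>R t ^ DIM(real^'n) - ?h x) < norm (?h x))"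
        by (rule exE)
      then show False using dense[of 0 \<delta>] by auto
    qed
    then have "{x \<in> cbox c d. h x \<noteq> 0} \<subseteq> N" by force
    then show ?thesis by (rule negligible_subset[OF N])
  qed
  obtain \<D> where D: "countable \<D>" "\<And>X. X \<in> \<D> \<Longrightarrow> X \<subseteq> U \<and> (\<exists>a b. X = cbox a b)" "\<Union>\<D> = U"
    using open_countable_Union_open_cbox[OF U] by (metis Pow_iff subset_eq)
  have "negligible (\<Union>X\<in>\<D>. {x \<in> X. h x \<noteq> 0})"
  proof (rule negligible_countable_Union)
    fix Y assume "Y \<in> (\<lambda>X. {x \<in> X. h x \<noteq> 0}) ` \<D>"
    then obtain X where X: "X \<in> \<D>" "Y = {x \<in> X. h x \<noteq> 0}" by blast
    then show "negligible Y" using D(2)[of X] K by auto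
  qed (use D(1) in simp)
  moreover have "(\<Union>X\<in>\<D>. {x \<in> X. h x \<noteq> 0}) = {x \<in> U. h x \<noteq> 0}" using D by auto
  ultimately have "{x \<in> U. h x \<noteq> 0} \<in> null_sets lebesgue" by (simp add: negligible_iff_null_sets)
  then have "AE x in lebesgue. x \<in> U \<longrightarrow> h x = 0" by (rule AE_I') auto
  then show ?thesis using U by (simp add: AE_restrict_space_iff)
qed

text \<open>Each component of the difference is orthogonal to all test functions, hence 0 almost
  everywhere; the finitely many exceptional null sets are then united.\<close>

lemma has_weak_gradient_unique:
  assumes "has_weak_gradient U f g" "has_weak_gradient U f k" "open U"
  shows "AE x in lebesgue_on U. g x = k x"
proof -
  note * = assms(1,2)[unfolded has_weak_gradient_iff[OF assms(3)]]
  have "AE x in lebesgue_on U. g x $ i + (-1) * k x $ i = 0" for i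
  proof (rule locally_integrable_AE_0[OF _ assms(3)])
    show "locally_integrable U (\<lambda>x. g x $ i + (-1) * k x $ i)"
      by (rule locally_integrable_add_scaled) (use * in auto)
    fix \<psi> assume \<psi>: "test_function U \<psi>"
    note int = test_function_integrable[OF _ \<psi>]
    have L: "locally_integrable U (\<lambda>x. g x $ i)" "locally_integrable U (\<lambda>x. k x $ i)"
      using * by auto
    have "- (LINT x|lebesgue. g x $ i * \<psi> x) = - (LINT x|lebesgue. k x $ i * \<psi> x)"
      using *(1)[THEN conjunct2, rule_format, of i, THEN conjunct2, rule_format, OF \<psi>]
        *(2)[THEN conjunct2, rule_format, of i, THEN conjunct2, rule_format, OF \<psi>] by (rule trans[OF sym])
    then show "(LINT x|lebesgue. (g x $ i + (-1) * k x $ i) * \<psi> x) = 0"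
      using Bochner_Integration.integral_diff[OF int(1)[OF L(1)] int(1)[OF L(2)]]
      by (simp add: left_diff_distrib)
  qed
  then have "AE x in lebesgue_on U. \<forall>i. g x $ i + (-1) * k x $ i = 0" by (simp add: AE_all_countable)
  then show ?thesis by (rule AE_mp) (auto simp: vec_eq_iff)
qed

lemma weak_grad_works: "has_weak_gradient U f g \<Longrightarrow> has_weak_gradient U f (weak_grad U f)"
  unfolding weak_grad_def by (rule someI[of "has_weak_gradient U f"])

text \<open>This makes the arbitrary choice in \<open>weak_grad\<close> harmless: any known weak
  gradient may replace it almost everywhere.\<close>

lemma weak_grad_AE_eq:
  "has_weak_gradient U f g \<Longrightarrow> open U \<Longrightarrow> AE x in lebesgue_on U. weak_grad U f x = g x"
  using has_weak_gradient_unique weak_grad_works by blast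

section \<open>Monotonicity from the weak gradient\<close>

lemma test_function_translate:
  assumes \<psi>: "test_function U \<psi>" and V: "\<And>x. x \<in> closure {x. \<psi> x \<noteq> 0} \<Longrightarrow> x + v \<in> V"
  shows "test_function V (\<lambda>x. \<psi> (x - v))"
proof -
  have "{x. \<psi> (x - v) \<noteq> 0} = (+) v ` {x. \<psi> x \<noteq> 0}"
    by (auto simp: image_iff intro!: exI[of _ "_ - v"])
  then have *: "closure {x. \<psi> (x - v) \<noteq> 0} = (+) v ` closure {x. \<psi> x \<noteq> 0}"
    by (simp only: closure_translation)
  have "\<forall>k. Ck k (\<lambda>x. \<psi> (x - v))" using \<psi> by (simp add: test_function_def Ck_translate)
  moreover have "compact ((+) v ` closure {x. \<psi> x \<noteq> 0})"
    using test_functionD(4)[OF \<psi>] by (rule compact_translation)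
  moreover have "(+) v ` closure {x. \<psi> x \<noteq> 0} \<subseteq> V" using V by (auto simp: add.commute)
  ultimately show ?thesis unfolding test_function_def * by blast
qed

lemma integral_bump_pos:
  assumes "box c d \<noteq> {}"
  shows "0 < (LINT x|lebesgue. bump c d 1 x)"
proof -
  have cont: "continuous_on (cbox c d) (bump c d 1)"
    using Ck_bump[of 0 c d 1] continuous_on_subset by auto
  have b: "bump c d 1 x = 0" if "x \<notin> cbox c d" for x
    using bump_support[of 1 c d] that box_subset_cbox[of c d] by auto
  have eq: "(LINT x|lebesgue. bump c d 1 x) = integral (cbox c d) (bump c d 1)"
    by (rule integrable_continuous_support(2)[OF cont compact_cbox b])
  obtain x where x: "x \<in> box c d" using assms by blast
  have "integral (cbox c d) (bump c d 1) \<noteq> 0"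
  proof
    assume "integral (cbox c d) (bump c d 1) = 0"
    then have "(bump c d 1 has_integral 0) (cbox c d)"
      using integrable_integral[OF integrable_continuous[OF cont]] by simp
    from has_integral_0_cbox_imp_0[OF cont bump_nonneg this assms] x box_subset_cbox[of c d]
    have "bump c d 1 x = 0" by blast
    then show False using bump_pos_iff[of 1 c d x] x by simp
  qed
  moreover have "0 \<le> integral (cbox c d) (bump c d 1)"
    by (rule integral_nonneg[OF integrable_continuous[OF cont] bump_nonneg])
  ultimately show ?thesis using eq by simp
qed

text \<open>A mean value inequality for a function with only a weak gradient. If it failed at
  \<open>x\<close>, continuity would make the increment of \<open>\<phi>\<close> along
  \<open>e\<close> stay below some \<open>b' < b\<close> near \<open>x\<close>; a bump concentrated
  there turns this and the lower bound on the gradient into \<open>b * I \<le> b' * I\<close> with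
  \<open>I > 0\<close>.\<close>

lemma weak_gradient_increase:
  fixes \<phi> :: "real^'n \<Rightarrow> real"
  assumes wg: "has_weak_gradient V \<phi> g" and V: "open V" and cont: "continuous_on V \<phi>"
    and pq: "cbox p q \<subseteq> V" and x: "x \<in> box p q" "x + e \<in> box p q"
    and ge: "AE z in lebesgue_on V. z \<in> cbox p q \<longrightarrow> b \<le> g z \<bullet> e"
  shows "\<phi> x + b \<le> \<phi> (x + e)"
proof (rule ccontr)
  assume "\<not> ?thesis"
  then obtain b' where b': "\<phi> (x + e) - \<phi> x < b'" "b' < b" using dense[of "\<phi> (x + e) - \<phi> x" b] by auto
  have bV: "box p q \<subseteq> V" using pq box_subset_cbox by blast
  have cx: "isCont \<phi> x" "isCont \<phi> (x + e)"
    using cont V bV x by (auto simp: continuous_on_eq_continuous_at)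
  have tx: "((\<lambda>z. z + e) \<longlongrightarrow> x + e) (nhds x)" "((\<lambda>z. z) \<longlongrightarrow> x) (nhds x)"
    by (auto intro!: tendsto_intros simp: filterlim_ident)
  have lim: "((\<lambda>z. \<phi> (z + e) - \<phi> z) \<longlongrightarrow> \<phi> (x + e) - \<phi> x) (nhds x)"
    by (intro tendsto_diff isCont_tendsto_compose[OF cx(2) tx(1)] isCont_tendsto_compose[OF cx(1) tx(2)])
  have "\<forall>\<^sub>F z in nhds x. z \<in> box p q \<and> z + e \<in> box p q \<and> \<phi> (z + e) - \<phi> z < b'"
    using topological_tendstoD[OF tx(2) open_box x(1)] topological_tendstoD[OF tx(1) open_box x(2)]
      order_tendstoD(2)[OF lim b'(1)] by eventually_elim blast
  then obtain W where W: "open W" "x \<in> W"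
    "\<And>z. z \<in> W \<Longrightarrow> z \<in> box p q \<and> z + e \<in> box p q \<and> \<phi> (z + e) - \<phi> z < b'"
    unfolding eventually_nhds by blast
  obtain c d where cd: "cbox c d \<subseteq> W" "x \<in> box c d"
    by (rule open_contains_cbox[OF W(1,2)])
  define \<psi> where "\<psi> = bump c d 1"
  have \<psi>: "test_function (cbox c d) \<psi>" unfolding \<psi>_def by (rule test_function_bump) auto
  have supp: "closure {x. \<psi> x \<noteq> 0} \<subseteq> cbox c d" using test_functionD(5)[OF \<psi>] .
  have \<psi>0: "0 \<le> \<psi> z" for z by (simp add: \<psi>_def bump_nonneg)
  have \<psi>z: "\<psi> z = 0" if "z \<notin> cbox c d" for z
    using zero_outside_support(1)[of z \<psi>] that supp by blast
  \<comment> \<open>Convexity of the box keeps the whole segment from \<open>z\<close> to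
    \<open>z + e\<close> inside it, so all the translated bumps live where the gradient bound is
    known.\<close>
  have mid: "z + s *\<^sub>R e \<in> box p q" if "z \<in> cbox c d" "s \<in> {0..1}" for z s
  proof -
    have "z \<in> box p q" "z + e \<in> box p q" using W(3)[of z] cd(1) that(1) by blast+
    then have "(1 - s) *\<^sub>R z + s *\<^sub>R (z + e) \<in> box p q"
      using that(2) by (intro convexD[OF convex_box(2)]) auto
    then show ?thesis by (simp add: algebra_simps)
  qed
  have \<psi>s: "test_function (box p q) (\<lambda>y. \<psi> (y - s *\<^sub>R e))" if "s \<in> {0..1}" for s
    using \<psi> by (rule test_function_translate) (use mid that supp in blast)
  have \<psi>sV: "test_function V (\<lambda>y. \<psi> (y - s *\<^sub>R e))" if "s \<in> {0..1}" for s
    using \<psi>s[OF that] bV by (auto simp: test_function_def)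
  have out: "\<psi> (y - s *\<^sub>R e) = 0" if "s \<in> {0..1}" "y \<notin> box p q" for s y
    using mid[of "y - s *\<^sub>R e" s] that by (intro \<psi>z) auto
  have frechet: "frechet_derivative (\<lambda>y. \<psi> (y - s *\<^sub>R e)) (at y) e = frechet_derivative \<psi> (at (y - s *\<^sub>R e)) e" for s y
    by (simp add: frechet_derivative_eq_sum_pderiv differentiable_translate test_functionD(1)[OF \<psi>] pderiv_at_translate)
  have cD: "continuous_on UNIV (\<lambda>y. frechet_derivative \<psi> (at y) e)"
    unfolding frechet_derivative_eq_sum_pderiv[OF test_functionD(1)[OF \<psi>]]
    by (intro continuous_on_sum continuous_on_mult continuous_on_const test_functionD(3)[OF \<psi>])
  have c\<psi>: "continuous_on UNIV \<psi>" by (rule test_functionD(2)[OF \<psi>])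
  have c\<phi>: "continuous_on (cbox p q) \<phi>" using cont pq by (rule continuous_on_subset)
  \<comment> \<open>The integral of \<open>\<phi>(y) \<psi>(y - s e)\<close> has \<open>s\<close>-derivative \<open>-\<integral> \<phi> \<partial>\<^sub>e\<psi>(\<cdot> - s e) = \<integral> (g \<bullet> e) \<psi>(\<cdot> - s e)\<close>,
    which is at least \<open>b \<integral> \<psi>\<close>. This avoids mollifying \<open>\<phi>\<close>.\<close>
  define P where "P s y = \<phi> y * \<psi> (y - s *\<^sub>R e)" for s y
  define P' where "P' s y = \<phi> y * (- frechet_derivative \<psi> (at (y - s *\<^sub>R e)) e)" for s y
  define I where "I = (LINT z|lebesgue. \<psi> z)"
  have I: "I > 0" unfolding I_def \<psi>_def using cd(2) by (intro integral_bump_pos) blast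
  have i\<psi>: "integrable lebesgue \<psi>"
    by (rule integrable_continuous_support(1)[of "cbox c d"])
       (use c\<psi> \<psi>z in \<open>auto intro: continuous_on_subset\<close>)
  have cP: "continuous_on UNIV (P s)" if "s \<in> {0..1}" for s
    unfolding P_def using test_functionD[OF \<psi>sV[OF that]]
    by (intro continuous_on_mult_support[where S="closure {y. \<psi> (y - s *\<^sub>R e) \<noteq> 0}", OF V cont])
       (auto intro: zero_outside_support(1))
  have Pz: "P s y = 0" if "s \<in> {0..1}" "y \<notin> cbox p q" for s y
    using out[OF that(1), of y] that(2) box_subset_cbox[of p q] by (auto simp: P_def)
  have iP: "integrable lebesgue (P s)" "integral\<^sup>L lebesgue (P s) = integral (cbox p q) (P s)" if "s \<in> {0..1}" for s
    by (rule integrable_continuous_support[OF continuous_on_subset[OF cP[OF that]] compact_cbox Pz[OF that]], simp_all)+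
  have D: "((\<lambda>s. integral (cbox p q) (P s)) has_vector_derivative integral (cbox p q) (P' s0)) (at s0 within {0..1})"
    if "s0 \<in> {0..1}" for s0
  proof (rule leibniz_rule_vector_derivative)
    fix s y
    have "((\<lambda>s. \<psi> (y - s *\<^sub>R e)) has_derivative (\<lambda>h. frechet_derivative \<psi> (at (y - s *\<^sub>R e)) (- (h *\<^sub>R e)))) (at s within {0..1})"
      using test_functionD(1)[OF \<psi>, of "y - s *\<^sub>R e", unfolded frechet_derivative_works]
      by (rule has_derivative_compose[rotated]) (auto intro!: derivative_eq_intros)
    then have "((\<lambda>s. \<psi> (y - s *\<^sub>R e)) has_vector_derivative - frechet_derivative \<psi> (at (y - s *\<^sub>R e)) e) (at s within {0..1})"
      using linear_frechet_derivative[OF test_functionD(1)[OF \<psi>, of "y - s *\<^sub>R e"]]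
      by (simp add: has_vector_derivative_def linear_neg linear_cmul)
    then show "((\<lambda>s. P s y) has_vector_derivative P' s y) (at s within {0..1})"
      unfolding P_def P'_def by (rule has_vector_derivative_mult_right)
  next
    fix s assume "s \<in> {0..1::real}"
    then show "P s integrable_on cbox p q"
      by (intro integrable_continuous continuous_on_subset[OF cP]) auto
  next
    show "continuous_on ({0..1} \<times> cbox p q) (\<lambda>(s, y). P' s y)"
      unfolding P'_def split_beta
      by (intro continuous_on_mult continuous_on_minus continuous_on_compose2[OF c\<phi>]
          continuous_on_compose2[OF cD] continuous_intros) auto
  qed (use that in auto)
  have P'_ge: "b * I \<le> integral (cbox p q) (P' s)" if s: "s \<in> {0..1}" for s
  proof -
    note dir = has_weak_gradient_directional[OF wg V \<psi>sV[OF s], of e, unfolded frechet]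
    have out': "P' s y = 0" if "y \<notin> cbox p q" for y
    proof -
      have "y \<notin> closure {y. \<psi> (y - s *\<^sub>R e) \<noteq> 0}"
        using test_functionD(5)[OF \<psi>s[OF s]] that box_subset_cbox[of p q] by blast
      from zero_outside_support(2)[OF this]
      have "frechet_derivative (\<lambda>y. \<psi> (y - s *\<^sub>R e)) (at y) e = 0"
        by (simp add: frechet_derivative_eq_sum_pderiv differentiable_translate test_functionD(1)[OF \<psi>])
      then show ?thesis by (simp add: P'_def frechet)
    qed
    have cP': "continuous_on (cbox p q) (P' s)"
      unfolding P'_def
      by (intro continuous_on_mult c\<phi> continuous_on_minus continuous_on_compose2[OF cD] continuous_intros) auto
    have "integral (cbox p q) (P' s) = integral\<^sup>L lebesgue (P' s)"
      by (rule integrable_continuous_support(2)[OF cP' compact_cbox out', symmetric])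
    also have "\<dots> = (LINT y|lebesgue. (g y \<bullet> e) * \<psi> (y - s *\<^sub>R e))"
      unfolding P'_def using dir(3) by simp
    also have "\<dots> \<ge> (LINT y|lebesgue. b * \<psi> (y - s *\<^sub>R e))"
    proof (rule integral_mono_AE[OF _ dir(2)])
      show "integrable lebesgue (\<lambda>y. b * \<psi> (y - s *\<^sub>R e))"
        using test_function_integrable(1)[OF locally_integrable_continuous[OF continuous_on_const] \<psi>sV[OF s]] .
      have "AE y in lebesgue. y \<in> V \<longrightarrow> y \<in> cbox p q \<longrightarrow> b \<le> g y \<bullet> e"
        using ge V by (simp add: AE_restrict_space_iff)
      then show "AE y in lebesgue. b * \<psi> (y - s *\<^sub>R e) \<le> (g y \<bullet> e) * \<psi> (y - s *\<^sub>R e)"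
      proof eventually_elim
        case (elim y)
        show ?case
        proof (cases "y \<in> box p q")
          case True
          then have "b \<le> g y \<bullet> e" using elim pq box_subset_cbox[of p q] by blast
          then show ?thesis using \<psi>0 by (rule mult_right_mono)
        qed (simp add: out[OF s])
      qed
    qed
    also have "(LINT y|lebesgue. b * \<psi> (y - s *\<^sub>R e)) = b * I"
      using integral_lebesgue_translate[of \<psi> "- (s *\<^sub>R e)"] borel_measurable_continuous_onI[OF c\<psi>]
      by (simp add: I_def)
    finally show ?thesis .
  qed
  define F where "F s = integral (cbox p q) (P s)" for s
  have "\<exists>s\<in>{0<..<1}. F 1 - F 0 = (1 - 0) *\<^sub>R integral (cbox p q) (P' s)"
    using D unfolding F_def has_vector_derivative_def by (intro mvt_simple) auto
  then have "b * I \<le> F 1 - F 0" using P'_ge by force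
  \<comment> \<open>The substitution \<open>y = z + e\<close> moves the shift from the bump to
    \<open>\<phi>\<close>.\<close>
  also have "F 1 = (LINT z|lebesgue. \<phi> (z + e) * \<psi> z)"
    using iP(2)[of 1] integral_lebesgue_translate[of "P 1" e, symmetric] borel_measurable_continuous_onI[OF cP[of 1]]
    by (simp add: F_def) (simp add: P_def)
  also have "F 0 = (LINT z|lebesgue. \<phi> z * \<psi> z)"
    using iP(2)[of 0] by (simp add: F_def P_def[abs_def])
  \<comment> \<open>The bump is supported in \<open>W\<close>, where the increment of
    \<open>\<phi>\<close> is below \<open>b'\<close>.\<close>
  also have "(LINT z|lebesgue. \<phi> (z + e) * \<psi> z) - (LINT z|lebesgue. \<phi> z * \<psi> z) \<le> b' * I"
  proof -
    have "continuous_on UNIV (\<lambda>z. P 1 (z + e))"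
      by (intro continuous_on_compose2[OF cP[of 1]] continuous_intros) auto
    then have i1: "integrable lebesgue (\<lambda>z. \<phi> (z + e) * \<psi> z)"
      by (intro integrable_continuous_support(1)[of "cbox c d"])
         (auto simp: P_def \<psi>z intro: continuous_on_subset)
    have i0: "integrable lebesgue (\<lambda>z. \<phi> z * \<psi> z)" using iP(1)[of 0] by (simp add: P_def[abs_def])
    have "(LINT z|lebesgue. \<phi> (z + e) * \<psi> z - \<phi> z * \<psi> z) \<le> (LINT z|lebesgue. b' * \<psi> z)"
    proof (rule integral_mono)
      fix z
      show "\<phi> (z + e) * \<psi> z - \<phi> z * \<psi> z \<le> b' * \<psi> z"
      proof (cases "z \<in> cbox c d")
        case True
        then have "\<phi> (z + e) - \<phi> z \<le> b'" using W(3) cd(1) by force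
        from mult_right_mono[OF this \<psi>0] show ?thesis by (simp add: left_diff_distrib)
      qed (simp add: \<psi>z)
    qed (use i0 i1 i\<psi> in auto)
    then show ?thesis using i0 i1 by (simp add: I_def)
  qed
  finally have "b * I \<le> b' * I" .
  then show False using I b'(2) by simp
qed

section \<open>Rank-one level-convexity at a local extremum\<close>

lemma tensor_linear:
  "tensor \<xi> 0 = 0" "tensor \<xi> (p + q) = tensor \<xi> p + tensor \<xi> q"
  "tensor \<xi> (p - q) = tensor \<xi> p - tensor \<xi> q" "tensor \<xi> (a *\<^sub>R p) = a *\<^sub>R tensor \<xi> p"
  by (simp_all add: tensor_def vec_eq_iff algebra_simps)

lemma continuous_on_tensor:
  "continuous_on S f \<Longrightarrow> continuous_on S (\<lambda>x. tensor \<xi> (f x))"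
  unfolding tensor_def by (intro continuous_intros)

text \<open>The image of the matrix lies in the span of \<open>\<xi>\<close>.\<close>

lemma rank_tensor_le: "rank (tensor \<xi> p) \<le> 1"
proof -
  have "tensor \<xi> p *v x = (p \<bullet> x) *\<^sub>R \<xi>" for x
    by (simp add: vec_eq_iff tensor_def matrix_vector_mult_def inner_vec_def sum_distrib_left sum_distrib_right mult_ac)
  then have "range (\<lambda>x. tensor \<xi> p *v x) \<subseteq> span {\<xi>}"
    by (auto simp: span_singleton)
  then have "dim (range (\<lambda>x. tensor \<xi> p *v x)) \<le> card {\<xi>}"
    by (rule dim_le_card) simp
  then show ?thesis by (simp add: rank_dim_range)
qed

text \<open>Any two matrices in the section differ by \<open>tensor \<xi> (p - q)\<close>, of rank
  at most one, so the restricted convexity of \<open>C\<close> applies to every pair of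
  points.\<close>

lemma convex_rank_one_section:
  assumes "rank_one_convex C"
  shows "convex {p. A + tensor \<xi> p \<in> C}"
proof (rule convexI)
  fix p q u v assume pq: "p \<in> {p. A + tensor \<xi> p \<in> C}" "q \<in> {p. A + tensor \<xi> p \<in> C}"
    and uv: "0 \<le> u" "0 \<le> v" "u + v = (1::real)"
  have "rank ((A + tensor \<xi> p) - (A + tensor \<xi> q)) \<le> 1"
    using rank_tensor_le[of \<xi> "p - q"] by (simp add: tensor_linear)
  then have "u *\<^sub>R (A + tensor \<xi> p) + (1 - u) *\<^sub>R (A + tensor \<xi> q) \<in> C"
    using assms[unfolded rank_one_convex_def, rule_format, of "A + tensor \<xi> p" "A + tensor \<xi> q" u] pq uv
    by simp
  moreover have "u *\<^sub>R (A + tensor \<xi> p) + (1 - u) *\<^sub>R (A + tensor \<xi> q) = A + tensor \<xi> (u *\<^sub>R p + v *\<^sub>R q)"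
  proof -
    have v: "v = 1 - u" using uv(3) by simp
    show ?thesis unfolding v by (simp add: tensor_linear algebra_simps)
  qed
  ultimately show "u *\<^sub>R p + v *\<^sub>R q \<in> {p. A + tensor \<xi> p \<in> C}" by simp
qed

text \<open>Both claims of the theorem reduce to this: (i) with \<open>V\<close> the whole
  subdomain, (ii) with \<open>V\<close> a ball. The bound \<open>M\<close> keeps the gradients in a
  compact set, on which the continuity of \<open>H\<close> is uniform.\<close>

lemma rank_one_level_convex_extremum:
  fixes H :: "real^'n \<Rightarrow> real^'n^'m \<Rightarrow> real" and J :: "real^'n \<Rightarrow> real^'n^'m"
  assumes V: "open V" and x0: "x0 \<in> V"
    and H: "continuous_on (V \<times> UNIV) (\<lambda>(x, P). H x P)" "\<And>P. 0 \<le> H x0 P"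
    and lc: "rank_one_level_convex V H"
    and J: "continuous_on V J"
    and wg: "has_weak_gradient V \<phi> g" and \<phi>: "continuous_on V \<phi>"
    and bd: "AE x in lebesgue_on V. norm (g x) \<le> M"
    and ext: "local_extremum V \<phi> x0"
    and le: "AE x in lebesgue_on V. H x (J x + tensor \<xi> (g x)) \<le> t"
  shows "H x0 (J x0) \<le> t"
proof (rule ccontr)
  assume "\<not> ?thesis"
  then obtain t' where t': "t < t'" "t' < H x0 (J x0)" using dense[of t "H x0 (J x0)"] by auto
  define G where "G x p = H x (J x + tensor \<xi> p)" for x p
  have G: "continuous_on (V \<times> UNIV) (\<lambda>(x, p). G x p)"
  proof -
    have "continuous_on (V \<times> UNIV) (\<lambda>z. (fst z, J (fst z) + tensor \<xi> (snd z)))"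
      by (intro continuous_on_Pair continuous_on_add continuous_on_tensor continuous_on_fst
          continuous_on_snd continuous_on_id continuous_on_compose2[OF J]) auto
    from continuous_on_compose2[OF H(1) this] show ?thesis
      by (simp add: G_def split_beta image_subset_iff)
  qed
  define C where "C = {p. G x0 p \<le> t'}"
  have "convex C"
  proof (cases "0 \<le> t'")
    case True
    then have "rank_one_convex {P. H x0 P \<le> t'}" using lc x0 by (auto simp: rank_one_level_convex_def)
    from convex_rank_one_section[OF this, of "J x0" \<xi>] show ?thesis by (simp add: C_def G_def)
  next
    \<comment> \<open>Level-convexity is stated for levels \<open>t \<ge> 0\<close> only; below 0
      the sublevel set is empty because \<open>H\<close> is nonnegative at
      \<open>x0\<close>.\<close>
    case False
    then have "\<not> G x0 p \<le> t'" for p using H(2)[of "J x0 + tensor \<xi> p"] by (simp add: G_def)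
    then show ?thesis by (simp add: C_def)
  qed
  moreover have "closed C"
  proof -
    have "continuous_on UNIV (\<lambda>p::real^'n. (x0, p))" by (intro continuous_intros)
    from continuous_on_compose2[OF G this] x0 have "continuous_on UNIV (\<lambda>p. G x0 p)"
      by (simp add: image_subset_iff)
    then show ?thesis unfolding C_def by (intro closed_Collect_le continuous_on_const)
  qed
  moreover have "0 \<notin> C" using t' by (simp add: C_def G_def tensor_linear)
  \<comment> \<open>Strict separation of a closed convex set, possibly empty, from the origin. The
    constant \<open>b\<close> becomes the growth rate of \<open>\<phi>\<close> along
    \<open>a\<close>.\<close>
  ultimately obtain a b where ab: "a \<noteq> 0" "0 < b" "\<And>p. p \<in> C \<Longrightarrow> b < a \<bullet> p"
    using separating_hyperplane_closed_0[of C] by blast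
  obtain r0 where r0: "0 < r0" "cball x0 r0 \<subseteq> V" using V x0 open_contains_cball by blast
  have "uniformly_continuous_on (cball x0 r0 \<times> cball 0 M) (\<lambda>(x, p). G x p)"
    by (intro compact_uniformly_continuous continuous_on_subset[OF G] compact_Times) (use r0 in auto)
  moreover have "0 < t' - t" using t'(1) by simp
  ultimately obtain r1 where r1: "0 < r1"
    "\<And>z z'. z \<in> cball x0 r0 \<times> cball 0 M \<Longrightarrow> z' \<in> cball x0 r0 \<times> cball 0 M \<Longrightarrow> dist z' z < r1
      \<Longrightarrow> dist ((\<lambda>(x, p). G x p) z') ((\<lambda>(x, p). G x p) z) < t' - t"
    unfolding uniformly_continuous_on_def by blast
  define r where "r = min r0 r1"
  have r: "0 < r" using r0 r1 by (simp add: r_def)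
  \<comment> \<open>Moving the base point from \<open>x\<close> to \<open>x0\<close> changes
    \<open>G\<close> by less than \<open>t' - t\<close>, so level \<open>t\<close> at
    \<open>x\<close> becomes level \<open>t'\<close> at \<open>x0\<close>. The gap between
    \<open>t\<close> and \<open>t'\<close> was left for this.\<close>
  have inC: "p \<in> C" if "x \<in> ball x0 r" "norm p \<le> M" "G x p \<le> t" for x p
  proof -
    have "dist (x, p) (x0, p) < r1" using that by (simp add: dist_Pair_Pair r_def dist_commute)
    then have "dist (G x p) (G x0 p) < t' - t"
      using r1(2)[of "(x0, p)" "(x, p)"] that r0 by (auto simp: r_def)
    then show ?thesis using that(3) by (simp add: C_def dist_real_def)
  qed
  have "x0 \<in> ball x0 r" using r by simp
  then obtain p q where pq: "cbox p q \<subseteq> ball x0 r" "x0 \<in> box p q"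
    by (rule open_contains_cbox[OF open_ball])
  have "ball x0 r \<subseteq> cball x0 r0" by (auto simp: r_def)
  with pq(1) r0(2) have pqV: "cbox p q \<subseteq> V" by blast
  have dir: "AE z in lebesgue_on V. z \<in> cbox p q \<longrightarrow> s * b \<le> g z \<bullet> (s *\<^sub>R a)" if "0 \<le> s" for s
    using bd le
  proof eventually_elim
    case (elim z)
    show ?case
    proof
      assume "z \<in> cbox p q"
      then have "g z \<in> C" using pq(1) elim by (intro inC) (auto simp: G_def)
      then have "b \<le> g z \<bullet> a" using ab(3)[of "g z"] by (simp add: inner_commute)
      then show "s * b \<le> g z \<bullet> (s *\<^sub>R a)" using that by (simp add: mult_left_mono)
    qed
  qed
  have tt: "((\<lambda>s. x0 + s *\<^sub>R a) \<longlongrightarrow> x0) (at_right 0)" "((\<lambda>s. x0 - s *\<^sub>R a) \<longlongrightarrow> x0) (at_right 0)"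
    by (auto intro!: tendsto_eq_intros)
  have box: "\<forall>\<^sub>F s in at_right 0. x0 + s *\<^sub>R a \<in> box p q \<and> x0 - s *\<^sub>R a \<in> box p q"
    using topological_tendstoD[OF tt(1) open_box pq(2)] topological_tendstoD[OF tt(2) open_box pq(2)]
    by eventually_elim blast
  \<comment> \<open>Points ahead along \<open>a\<close> exclude a local maximum, points behind
    exclude a local minimum. The second inequality is the same increase, started from
    \<open>x0 - s *\<^sub>R a\<close>.\<close>
  have grow: "\<phi> x0 < \<phi> (x0 + s *\<^sub>R a)" "\<phi> (x0 - s *\<^sub>R a) < \<phi> x0"
    if s: "0 < s" "x0 + s *\<^sub>R a \<in> box p q \<and> x0 - s *\<^sub>R a \<in> box p q" for s
  proof -
    have "0 < s * b" using s(1) ab(2) by simp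
    moreover have "\<phi> x0 + s * b \<le> \<phi> (x0 + s *\<^sub>R a)"
      using s pq(2) by (intro weak_gradient_increase[OF wg V \<phi> pqV _ _ dir]) auto
    moreover have "\<phi> (x0 - s *\<^sub>R a) + s * b \<le> \<phi> (x0 - s *\<^sub>R a + s *\<^sub>R a)"
      using s pq(2) by (intro weak_gradient_increase[OF wg V \<phi> pqV _ _ dir]) auto
    ultimately show "\<phi> x0 < \<phi> (x0 + s *\<^sub>R a)" "\<phi> (x0 - s *\<^sub>R a) < \<phi> x0" by auto
  qed
  have pos: "\<forall>\<^sub>F s in at_right 0. (0::real) < s" by (simp add: eventually_at_right_less)
  \<comment> \<open>The filter \<open>at x0 within V\<close> excludes \<open>x0\<close> itself; here
    \<open>a \<noteq> 0\<close> enters.\<close>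
  have fl: "filterlim (\<lambda>s. x0 + s *\<^sub>R a) (at x0 within V) (at_right 0)"
    "filterlim (\<lambda>s. x0 - s *\<^sub>R a) (at x0 within V) (at_right 0)"
  proof -
    have "\<forall>\<^sub>F s in at_right 0. x0 + s *\<^sub>R a \<in> V \<and> x0 + s *\<^sub>R a \<noteq> x0"
      "\<forall>\<^sub>F s in at_right 0. x0 - s *\<^sub>R a \<in> V \<and> x0 - s *\<^sub>R a \<noteq> x0"
      using box pos by (eventually_elim, use pqV box_subset_cbox[of p q] ab(1) in auto)+
    with tt show "filterlim (\<lambda>s. x0 + s *\<^sub>R a) (at x0 within V) (at_right 0)"
      "filterlim (\<lambda>s. x0 - s *\<^sub>R a) (at x0 within V) (at_right 0)"
      by (simp_all add: filterlim_at)
  qed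
  from ext consider "\<forall>\<^sub>F y in at x0 within V. \<phi> y \<le> \<phi> x0" | "\<forall>\<^sub>F y in at x0 within V. \<phi> x0 \<le> \<phi> y"
    by (auto simp: local_extremum_def)
  \<comment> \<open>The filter \<open>at_right 0\<close> is nontrivial, so a contradiction for all
    small \<open>s > 0\<close> suffices.\<close>
  then have "\<forall>\<^sub>F s in at_right (0::real). False"
  proof cases
    case 1
    from eventually_compose_filterlim[OF this fl(1)] box pos show ?thesis
    proof eventually_elim
      case (elim s)
      with grow(1)[of s] show False by linarith
    qed
  next
    case 2
    from eventually_compose_filterlim[OF this fl(2)] box pos show ?thesis
    proof eventually_elim
      case (elim s)
      with grow(2)[of s] show False by linarith
    qed
  qed
  then show False by simp
qed

section \<open>Rank-one absolute minimality\<close>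

lemma has_weak_gradient_cong:
  assumes wg: "has_weak_gradient U f g" and U: "open U" and eq: "\<And>x. x \<in> U \<Longrightarrow> g x = k x"
  shows "has_weak_gradient U f k"
proof -
  have "locally_integrable U (\<lambda>x. k x $ i) \<longleftrightarrow> locally_integrable U (\<lambda>x. g x $ i)" for i
    unfolding locally_integrable_def
    by (intro all_cong1 imp_cong refl Bochner_Integration.integrable_cong) (auto simp: eq subset_iff)
  moreover have "(LINT x|lebesgue_on U. k x $ i * \<psi> x) = (LINT x|lebesgue_on U. g x $ i * \<psi> x)" for i \<psi>
    by (rule Bochner_Integration.integral_cong) (simp_all add: eq)
  ultimately show ?thesis using wg by (simp add: has_weak_gradient_def)
qed

lemma component_has_weak_gradient:
  fixes u :: "real^'n \<Rightarrow> real^'m"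
  assumes u: "C1_on \<Omega> u" and V: "open V" "V \<subseteq> \<Omega>"
  shows "has_weak_gradient V (\<lambda>y. u y $ \<alpha>) (\<lambda>x. jacobian u (at x) $ \<alpha>)"
proof -
  have D: "((\<lambda>y. u y $ \<alpha>) has_derivative (\<lambda>h. (jacobian u (at x) *v h) $ \<alpha>)) (at x)" if "x \<in> V" for x
  proof (rule bounded_linear.has_derivative[OF bounded_linear_vec_nth])
    show "(u has_derivative (\<lambda>h. jacobian u (at x) *v h)) (at x)"
      using u that V(2) by (auto simp: C1_on_def jacobian_works)
  qed
  have p: "pderiv_at i (\<lambda>y. u y $ \<alpha>) x = jacobian u (at x) $ \<alpha> $ i" if "x \<in> V" for i x
    by (simp add: pderiv_at_eq[OF D[OF that]] matrix_vector_mul_component inner_axis)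
  have J: "continuous_on V (\<lambda>x. jacobian u (at x))"
    using u V(2) by (auto simp: C1_on_def intro: continuous_on_subset)
  have "has_weak_gradient V (\<lambda>y. u y $ \<alpha>) (\<lambda>x. \<chi> i. pderiv_at i (\<lambda>y. u y $ \<alpha>) x)"
  proof (rule has_weak_gradient_classical[OF V(1)])
    show "(\<lambda>y. u y $ \<alpha>) differentiable at x" if "x \<in> V" for x
      using D[OF that] by (auto simp: differentiable_def)
    show "continuous_on V (pderiv_at i (\<lambda>y. u y $ \<alpha>))" for i
      by (rule continuous_on_cong[THEN iffD2, OF refl p]) (auto intro!: continuous_intros J)
  qed
  then show ?thesis
    by (rule has_weak_gradient_cong[OF _ V(1)]) (simp add: vec_eq_iff p)
qed

lemma weak_jacobian_AE_eq:
  assumes "\<And>\<alpha>. has_weak_gradient U (\<lambda>y. v y $ \<alpha>) (\<lambda>x. G x $ \<alpha>)" "open U"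
  shows "AE x in lebesgue_on U. weak_jacobian U v x = G x"
proof -
  have "AE x in lebesgue_on U. \<forall>\<alpha>. weak_grad U (\<lambda>y. v y $ \<alpha>) x = G x $ \<alpha>"
    using weak_grad_AE_eq[OF assms] by (simp add: AE_all_countable)
  then show ?thesis by (rule AE_mp) (simp add: weak_jacobian_def vec_eq_iff)
qed

text \<open>The closure of \<open>U\<close> is compact and lies in the domain of continuity, so
  \<open>f\<close> is bounded on it.\<close>

lemma L_inf_continuous:
  fixes f :: "real^'n \<Rightarrow> 'b::euclidean_space"
  assumes U: "compactly_inside U \<Omega>" and f: "continuous_on \<Omega> f"
  shows "L_inf U f"
proof -
  have U': "open U" "compact (closure U)" "closure U \<subseteq> \<Omega>" using U by (auto simp: compactly_inside_def)
  have "bounded (f ` closure U)"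
    using U' f by (intro compact_imp_bounded compact_continuous_image) (auto intro: continuous_on_subset)
  then obtain B where B: "\<And>x. x \<in> closure U \<Longrightarrow> norm (f x) \<le> B" by (auto simp: bounded_iff)
  have "continuous_on U f" using f U'(3) closure_subset[of U] continuous_on_subset by blast
  then have "f \<in> borel_measurable (lebesgue_on U)"
    using U'(1) by (simp add: continuous_imp_measurable_on_sets_lebesgue)
  moreover have "AE x in lebesgue_on U. norm (f x) \<le> B"
    using B closure_subset[of U] by (intro AE_I2) auto
  ultimately show ?thesis by (auto simp: L_inf_def)
qed

lemma C1_imp_W1_inf_loc_vec:
  fixes u :: "real^'n \<Rightarrow> real^'m"
  assumes u: "C1_on \<Omega> u"
  shows "W1_inf_loc_vec \<Omega> u"
  unfolding W1_inf_loc_vec_def W1_inf_def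
proof (intro allI impI conjI exI)
  fix U \<alpha> assume U: "compactly_inside U \<Omega>"
  then have U': "open U" "U \<subseteq> \<Omega>" using closure_subset[of U] by (auto simp: compactly_inside_def)
  have "continuous_on \<Omega> u"
    using u by (meson C1_on_def continuous_at_imp_continuous_on differentiable_imp_continuous_within)
  then show "L_inf U (\<lambda>x. u x $ \<alpha>)" by (intro L_inf_continuous[OF U] continuous_intros)
  show "has_weak_gradient U (\<lambda>y. u y $ \<alpha>) (\<lambda>x. jacobian u (at x) $ \<alpha>)"
    by (rule component_has_weak_gradient[OF u U'])
  show "L_inf U (\<lambda>x. jacobian u (at x) $ \<alpha>)"
    using u by (intro L_inf_continuous[OF U] continuous_intros) (simp add: C1_on_def)
qed

text \<open>\<open>esssup_I\<close> asks for measurability, which a chosen weak Jacobian does not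
  supply by itself; it comes from the completeness of Lebesgue measure, since \<open>f\<close>
  agrees almost everywhere with a constant.\<close>

lemma esssup_le_of_AE_const:
  fixes f :: "real^'n \<Rightarrow> real"
  assumes U: "open U" and eq: "AE x in lebesgue_on U. f x = c"
  shows "esssup (lebesgue_on U) (\<lambda>x. ereal (f x)) \<le> ereal c"
proof (rule esssup_I)
  have "AE x in lebesgue. c = (if x \<in> U then f x else c)"
    using eq U by (auto simp: AE_restrict_space_iff elim: eventually_mono)
  then have "(\<lambda>x. if x \<in> U then f x else c) \<in> borel_measurable lebesgue"
    by (rule borel_measurable_AE[rotated]) simp
  then have "(\<lambda>x. if x \<in> U then f x else c) \<in> borel_measurable (lebesgue_on U)"
    by (rule measurable_restrict_space1)
  then have "f \<in> borel_measurable (lebesgue_on U)"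
    by (rule measurable_cong[THEN iffD1, rotated]) simp
  then show "(\<lambda>x. ereal (f x)) \<in> borel_measurable (lebesgue_on U)" by simp
  show "AE x in lebesgue_on U. ereal (f x) \<le> ereal c" using eq by (rule AE_mp) simp
qed

text \<open>If maximum and minimum over the closure both lie on the boundary, both are 0 and the
  function vanishes on \<open>U\<close>; then every point of \<open>U\<close> is a non-strict
  extremum.\<close>

lemma exists_local_extremum:
  fixes \<phi> :: "real^'n \<Rightarrow> real"
  assumes "compact (closure U)" "open U" "U \<noteq> {}" "continuous_on (closure U) \<phi>" "\<And>x. x \<in> frontier U \<Longrightarrow> \<phi> x = 0"
  obtains x where "local_extremum U \<phi> x"
proof -
  have ne: "closure U \<noteq> {}" using assms(3) by simp
  obtain a where a: "a \<in> closure U" "\<And>y. y \<in> closure U \<Longrightarrow> \<phi> y \<le> \<phi> a"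
    using continuous_attains_sup[OF assms(1) ne assms(4)] by blast
  obtain b where b: "b \<in> closure U" "\<And>y. y \<in> closure U \<Longrightarrow> \<phi> b \<le> \<phi> y"
    using continuous_attains_inf[OF assms(1) ne assms(4)] by blast
  have cl: "y \<in> U \<Longrightarrow> y \<in> closure U" for y using closure_subset by blast
  have max: "local_extremum U \<phi> x" if "x \<in> U" "\<And>y. y \<in> U \<Longrightarrow> \<phi> y \<le> \<phi> x" for x
    using that by (auto simp: local_extremum_def eventually_at_filter)
  have min: "local_extremum U \<phi> x" if "x \<in> U" "\<And>y. y \<in> U \<Longrightarrow> \<phi> x \<le> \<phi> y" for x
    using that by (auto simp: local_extremum_def eventually_at_filter)
  show thesis
  proof (cases "a \<in> U \<or> b \<in> U")
    case True
    then show ?thesis using max[of a] min[of b] a(2) b(2) cl that by blast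
  next
    case False
    then have "a \<in> frontier U" "b \<in> frontier U"
      using a(1) b(1) assms(2) by (auto simp: frontier_def interior_open)
    then have z: "\<phi> a = 0" "\<phi> b = 0" using assms(5) by auto
    obtain x where x: "x \<in> U" using assms(3) by blast
    have "\<phi> x = 0" using a(2)[OF cl[OF x]] b(2)[OF cl[OF x]] z by simp
    then have "local_extremum U \<phi> x" using a(2) z cl x by (intro max) auto
    then show ?thesis by (rule that)
  qed
qed

text \<open>\<open>G\<close> stands for any representative of the perturbed gradient: in (i) it is
  assembled from \<open>weak_jacobian\<close> and \<open>weak_grad\<close>, in (ii) it is the
  \<open>weak_jacobian\<close> of the perturbed map.\<close>

lemma le_esssup_extremum:
  fixes H :: "real^'n \<Rightarrow> real^'n^'m \<Rightarrow> real" and u :: "real^'n \<Rightarrow> real^'m"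
  assumes H: "continuous_on (\<Omega> \<times> UNIV) (\<lambda>(x, P). H x P)" "\<And>x P. x \<in> \<Omega> \<Longrightarrow> H x P \<ge> 0"
    and lc: "rank_one_level_convex \<Omega> H" and u: "C1_on \<Omega> u"
    and V: "open V" "V \<subseteq> \<Omega>" and ext: "local_extremum V \<phi> x0"
    and wg: "has_weak_gradient V \<phi> g" and \<phi>: "continuous_on V \<phi>"
    and bd: "AE x in lebesgue_on V. norm (g x) \<le> M"
    and G: "AE x in lebesgue_on V. G x = jacobian u (at x) + tensor \<xi> (g x)"
  shows "ereal (H x0 (jacobian u (at x0))) \<le> esssup (lebesgue_on V) (\<lambda>x. ereal (H x (G x)))"
proof (rule ereal_le_real)
  \<comment> \<open>Comparing with real upper bounds \<open>t\<close> avoids treating infinite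
    essential suprema separately.\<close>
  fix t assume t: "esssup (lebesgue_on V) (\<lambda>x. ereal (H x (G x))) \<le> ereal t"
  have x0: "x0 \<in> V" using ext by (simp add: local_extremum_def)
  \<comment> \<open>A non-measurable function has essential supremum \<infinity>, so this bound
    holds for whatever representative \<open>G\<close> is.\<close>
  have "AE x in lebesgue_on V. ereal (H x (G x)) \<le> esssup (lebesgue_on V) (\<lambda>x. ereal (H x (G x)))"
    by (rule esssup_AE)
  with G have le: "AE x in lebesgue_on V. H x (jacobian u (at x) + tensor \<xi> (g x)) \<le> t"
  proof eventually_elim
    case (elim x)
    then have "ereal (H x (G x)) \<le> ereal t" using t by (metis order_trans)
    then show ?case using elim(1) by simp
  qed
  have "H x0 (jacobian u (at x0)) \<le> t"
  proof (rule rank_one_level_convex_extremum[where J = "\<lambda>x. jacobian u (at x)" and H = H and g = g and \<xi> = \<xi> and t = t,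
        OF V(1) x0 _ _ _ _ wg \<phi> bd ext le])
    show "continuous_on (V \<times> UNIV) (\<lambda>(x, P). H x P)"
      by (rule continuous_on_subset[OF H(1)]) (use V(2) in auto)
    show "0 \<le> H x0 P" for P using H(2) x0 V(2) by blast
    show "rank_one_level_convex V H" using lc V(2) by (auto simp: rank_one_level_convex_def)
    show "continuous_on V (\<lambda>x. jacobian u (at x))"
      using u V(2) by (auto simp: C1_on_def intro: continuous_on_subset)
  qed
  then show "ereal (H x0 (jacobian u (at x0))) \<le> ereal t" by simp
qed

theorem theorem1:
  fixes \<Omega> :: "(real^'n) set"
    and H :: "real^'n \<Rightarrow> real^'n^'m \<Rightarrow> real"
    and u :: "real^'n \<Rightarrow> real^'m"
    and c :: real
  assumes "open \<Omega>"
    and "continuous_on (\<Omega> \<times> UNIV) (\<lambda>(x, P). H x P)"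
    and "\<And>x P. x \<in> \<Omega> \<Longrightarrow> H x P \<ge> 0"
    and "rank_one_level_convex \<Omega> H"
    and "C1_on \<Omega> u"
    and "c \<ge> 0"
    and "\<And>x. x \<in> \<Omega> \<Longrightarrow> H x (jacobian u (at x)) = c"
  shows "rank_one_absolute_minimiser H \<Omega> u \<and>
    (\<forall>\<Omega>' \<phi> \<xi>. compactly_inside \<Omega>' \<Omega> \<and> W1_inf_0 \<Omega>' \<phi> \<longrightarrow>
       E_inf H u \<Omega>' \<le> (INF B\<in>extremal_balls \<phi> \<Omega>'. E_inf H (\<lambda>x. u x + \<phi> x *\<^sub>R \<xi>) B))"
proof -
  let ?J = "\<lambda>x. jacobian u (at x)"
  have sub: "open U \<and> U \<subseteq> \<Omega>" if "compactly_inside U \<Omega>" for U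
    using that closure_subset[of U] by (auto simp: compactly_inside_def)
  have wj: "AE x in lebesgue_on U. weak_jacobian U u x = ?J x" if "open U" "U \<subseteq> \<Omega>" for U
    using component_has_weak_gradient[OF assms(5) that] that(1) by (rule weak_jacobian_AE_eq)
  \<comment> \<open>The constant \<open>c\<close> separates the two sides: it bounds the unperturbed
    energy from above here, and every perturbed energy around an extremum from below in
    \<open>lower\<close>.\<close>
  have upper: "E_inf H u U \<le> ereal c" if "compactly_inside U \<Omega>" for U
  proof -
    have U: "open U" "U \<subseteq> \<Omega>" using sub[OF that] by auto
    have "AE x in lebesgue_on U. x \<in> U" by (rule AE_I2) simp
    with wj[OF U] have "AE x in lebesgue_on U. H x (weak_jacobian U u x) = c"
    proof eventually_elim
      case (elim x)
      then show ?case using assms(7)[of x] U(2) by auto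
    qed
    then show ?thesis unfolding E_inf_def by (rule esssup_le_of_AE_const[OF U(1)])
  qed
  have lower: "ereal c \<le> esssup (lebesgue_on V) (\<lambda>x. ereal (H x (G x)))"
    if V: "open V" "V \<subseteq> \<Omega>" and ext: "local_extremum V \<phi> x0"
      and wg: "has_weak_gradient V \<phi> g" and \<phi>: "continuous_on V \<phi>"
      and bd: "AE x in lebesgue_on V. norm (g x) \<le> M"
      and G: "AE x in lebesgue_on V. G x = ?J x + tensor \<xi> (g x)"
    for V \<phi> x0 g M G \<xi>
  proof -
    have "x0 \<in> \<Omega>" using ext V(2) by (auto simp: local_extremum_def)
    then show ?thesis
      using le_esssup_extremum[OF assms(2-5) V ext wg \<phi> bd G] assms(7) by simp
  qed
  have grad: "\<exists>g M. has_weak_gradient U \<phi> g \<and> (AE x in lebesgue_on U. norm (g x) \<le> M)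
      \<and> continuous_on (closure U) \<phi> \<and> (\<forall>x\<in>frontier U. \<phi> x = 0)"
    if "W1_inf_0 U \<phi>" for U \<phi>
    using that by (auto simp: W1_inf_0_def W1_inf_def L_inf_def)
  have i: "E_inf H u U \<le> esssup (lebesgue_on U)
      (\<lambda>x. ereal (H x (weak_jacobian U u x + tensor \<xi> (weak_grad U \<phi> x))))"
    if U: "compactly_inside U \<Omega>" and \<phi>: "W1_inf_0 U \<phi>" for U \<phi> \<xi>
  proof (cases "U = {}")
    \<comment> \<open>An empty \<open>U\<close> contains no extremum, but the essential supremum
      over it is -\<infinity>.\<close>
    case True
    have "E_inf H u U = - \<infinity>"
      unfolding E_inf_def True by (rule esssup_zero_space) (simp_all add: measurable_def)
    then show ?thesis by simp
  next
    case False
    obtain g M where g: "has_weak_gradient U \<phi> g" "AE x in lebesgue_on U. norm (g x) \<le> M"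
      "continuous_on (closure U) \<phi>" "\<forall>x\<in>frontier U. \<phi> x = 0" using grad[OF \<phi>] by blast
    have U': "open U" "U \<subseteq> \<Omega>" using sub[OF U] by auto
    obtain x0 where x0: "local_extremum U \<phi> x0"
      using exists_local_extremum[of U \<phi>] False U U' g by (auto simp: compactly_inside_def)
    have "AE x in lebesgue_on U. weak_jacobian U u x + tensor \<xi> (weak_grad U \<phi> x) = ?J x + tensor \<xi> (g x)"
      using wj[OF U'] weak_grad_AE_eq[OF g(1) U'(1)] by eventually_elim simp
    from lower[OF U' x0 g(1) continuous_on_subset[OF g(3) closure_subset] g(2) this] upper[OF U]
    show ?thesis by (rule order_trans[rotated])
  qed
  have ii: "E_inf H u U \<le> E_inf H (\<lambda>x. u x + \<phi> x *\<^sub>R \<xi>) B"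
    if U: "compactly_inside U \<Omega>" and \<phi>: "W1_inf_0 U \<phi>" and B: "B \<in> extremal_balls \<phi> U" for U \<phi> \<xi> B
  proof -
    obtain x0 \<rho> where x0: "B = ball x0 \<rho>" "\<rho> > 0" "compactly_inside B U" "local_extremum U \<phi> x0"
      using B by (auto simp: extremal_balls_def)
    obtain g M where g: "has_weak_gradient U \<phi> g" "AE x in lebesgue_on U. norm (g x) \<le> M"
      "continuous_on (closure U) \<phi>" using grad[OF \<phi>] by blast
    have U': "open U" "U \<subseteq> \<Omega>" using sub[OF U] by auto
    have oB: "open B" "B \<subseteq> U" using x0(3) closure_subset[of B] by (auto simp: compactly_inside_def)
    have B\<Omega>: "B \<subseteq> \<Omega>" using oB U' by blast
    \<comment> \<open>Both sets are open and contain \<open>x0\<close>, so the two filters at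
      \<open>x0\<close> coincide and extremality passes from \<open>U\<close> to the ball.\<close>
    have ext: "local_extremum B \<phi> x0"
      using x0 U' oB by (auto simp: local_extremum_def at_within_open[of _ U] at_within_open[of _ "ball x0 \<rho>"])
    have gB: "has_weak_gradient B \<phi> g" using g(1) U'(1) oB by (rule has_weak_gradient_subset)
    have bd: "AE x in lebesgue_on B. norm (g x) \<le> M"
      using g(2) U'(1) oB by (auto simp: AE_restrict_space_iff elim!: eventually_mono)
    have c\<phi>: "continuous_on B \<phi>" using g(3) oB(2) closure_subset[of U] continuous_on_subset by blast
    \<comment> \<open>Componentwise, adding \<open>\<phi> y *\<^sub>R \<xi>\<close> adds
      \<open>\<xi> $ \<alpha>\<close> times the weak gradient of \<open>\<phi>\<close>, which is row
      \<open>\<alpha>\<close> of \<open>tensor \<xi> (g x)\<close>.\<close>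
    have "has_weak_gradient B (\<lambda>y. (u y + \<phi> y *\<^sub>R \<xi>) $ \<alpha>) (\<lambda>x. (?J x + tensor \<xi> (g x)) $ \<alpha>)" for \<alpha>
    proof -
      have "(\<lambda>y. (u y + \<phi> y *\<^sub>R \<xi>) $ \<alpha>) = (\<lambda>y. u y $ \<alpha> + \<xi> $ \<alpha> * \<phi> y)"
        "(\<lambda>x. (?J x + tensor \<xi> (g x)) $ \<alpha>) = (\<lambda>x. ?J x $ \<alpha> + \<xi> $ \<alpha> *\<^sub>R g x)"
        by (simp_all add: fun_eq_iff tensor_def vec_eq_iff)
      then show ?thesis
        using has_weak_gradient_add_scaled[OF component_has_weak_gradient[OF assms(5) oB(1) B\<Omega>] gB oB(1)] by simp
    qed
    then have "AE x in lebesgue_on B. weak_jacobian B (\<lambda>x. u x + \<phi> x *\<^sub>R \<xi>) x = ?J x + tensor \<xi> (g x)"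
      using oB(1) by (rule weak_jacobian_AE_eq)
    from lower[OF oB(1) B\<Omega> ext gB c\<phi> bd this] upper[OF U]
    show ?thesis unfolding E_inf_def[of H "\<lambda>x. u x + \<phi> x *\<^sub>R \<xi>"] by (rule order_trans[rotated])
  qed
  show ?thesis
    unfolding rank_one_absolute_minimiser_def
    using C1_imp_W1_inf_loc_vec[OF assms(5)] i ii by (auto intro!: INF_greatest)
qed

end
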